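(* Let $f(x)\in\mathbb{Z}[x]$ be a nonconstant polynomial with nonzero discriminant. Assume the abc conjecture is true. Then there exists a bound $P_0$ such that for every prime $p>P_0$ and every integer $r$ not divisible by $p$, there exist infinitely many $d\in S_{\mathbb{Z}}(f)$ such that $d\equiv r\pmod p$.
   Context: For a squarefree integer $d$, let $C_d$ denote the curve $dy^2=f(x)$ over $\mathbb{Q}$. $S_{\mathbb{Z}}(f)$ denotes the set of all squarefree integers $d$ such that $C_d$ has a nontrivial integral point, i.e., there exist integers $x_0,y_0$ with $y_0\neq 0$ and $dy_0^2=f(x_0)$. *)

theory Defs
  imports
    Complex_Main
    "HOL-Computational_Algebra.Squarefree"
    "HOL-Number_Theory.Cong"
    "Subresultants.Resultant_Prelim"
begin

text \<open>
  With $n = \deg f$ and $a$ the leading coefficient of $f$, the discriminant is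
  $(-1)^{n(n-1)/2} \, a^{-1} \, \mathrm{Res}(f, f')$.  The division is exact
  (lemma \<open>lead_coeff_dvd_resultant_pderiv\<close> below).
\<close>

definition discriminant :: "int poly \<Rightarrow> int" where
  "discriminant f =
     (-1) ^ (degree f * (degree f - 1) div 2) * (resultant f (pderiv f) div lead_coeff f)"

lemma lead_coeff_dvd_resultant_pderiv:
  fixes f :: "int poly"
  assumes "degree f > 0"
  shows "lead_coeff f dvd resultant f (pderiv f)"
proof -
  let ?n = "degree f" and ?m = "degree f - 1"
  let ?S = "sylvester_mat f (pderiv f)"
  have d: "degree (pderiv f) = ?m"
    by (simp add: degree_pderiv)
  have S: "?S \<in> carrier_mat (?n + ?m) (?n + ?m)"
    using sylvester_carrier_mat[of f "pderiv f"] by (simp add: d)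
  have entry: "lead_coeff f dvd ?S $$ (i, 0)" if "i < ?n + ?m" for i
  proof (cases "i < ?m")
    case True
    with that show ?thesis
      by (auto simp: sylvester_mat_def sylvester_mat_sub_def d)
  next
    case False
    show ?thesis
    proof (cases "i = ?m")
      case True
      with that assms have "?S $$ (i, 0) = coeff (pderiv f) ?m"
        by (simp add: sylvester_mat_def sylvester_mat_sub_def d)
      with assms show ?thesis
        by (simp add: coeff_pderiv)
    next
      case False
      with that assms \<open>\<not> i < ?m\<close> show ?thesis
        by (auto simp: sylvester_mat_def sylvester_mat_sub_def d coeff_pderiv coeff_eq_0)
    qed
  qed
  have "det ?S = (\<Sum>i<?n + ?m. ?S $$ (i, 0) * cofactor ?S i 0)"
    using assms by (intro laplace_expansion_column[OF S]) auto
  also have "lead_coeff f dvd \<dots>"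
    by (intro dvd_sum dvd_mult2 entry) auto
  finally show ?thesis
    by (simp add: resultant_def)
qed

definition radical :: "nat \<Rightarrow> nat" where
  "radical n = \<Prod>(prime_factors n)"

definition abc_conjecture :: bool where
  "abc_conjecture \<longleftrightarrow>
     (\<forall>\<epsilon>::real. \<epsilon> > 0 \<longrightarrow>
       (\<exists>K::real. \<forall>a b c::nat. a > 0 \<longrightarrow> b > 0 \<longrightarrow> coprime a b \<longrightarrow> a + b = c \<longrightarrow>
          real c < K * real (radical (a * b * c)) powr (1 + \<epsilon>)))"

text \<open>
  The set $S_{\mathbb{Z}}(f)$.  Negative \<open>d\<close> and \<open>d = 1\<close> are allowed; \<open>0\<close> is not squarefree.
\<close>

definition S_Z :: "int poly \<Rightarrow> int set" where
  "S_Z f = {d. squarefree d \<and> (\<exists>x y :: int. y \<noteq> 0 \<and> d * y\<^sup>2 = poly f x)}"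

end

theory Submission
  imports
    Defs
    "HOL-Computational_Algebra.Field_as_Ring"
    "HOL-Number_Theory.Number_Theory"
    "HOL-Algebra.Algebraic_Closure_Type"
    "Berlekamp_Zassenhaus.Finite_Field"
begin

text \<open>
  Write \<open>d y\<^sup>2 = f(x)\<close>.  The residue of \<open>d\<close> mod \<open>p\<close> is controlled by forcing \<open>y = y\<^sub>1 y\<^sub>0\<close>, where \<open>y\<^sub>1\<close>
  comes from the fixed small primes and \<open>y\<^sub>0\<close> is built from primes modulo which \<open>f\<close> has a root.
  Such \<open>y\<^sub>0\<close>, for instance the values of \<open>f\<close> divided by their fixed part, represent a subgroup of
  \<open>(\<int>/p)\<^sup>*\<close>; it is the whole group and \<open>f\<close> meets both square classes, because by Stepanov's method the
  nonzero values of \<open>f\<close> mod \<open>p\<close> cannot lie in a single coset of a proper subgroup when \<open>p\<close> is large.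

  By Hensel and the Chinese remainder theorem it remains to find, in an arithmetic progression,
  arguments \<open>x\<close> for which \<open>f(x)\<close> has no square divisor \<open>q\<^sup>2\<close> with \<open>q\<close> a new prime.  Primes
  \<open>q \<le> \<delta>N\<close> are handled by counting.  For larger \<open>q\<close>, a Belyi polynomial for \<open>f(x) f(x+A)\<close> turns abc into the
  lower bound \<open>rad (f(x) f(x+A)) \<gg> |x|\<^bsup>2n-1-\<epsilon>\<^esup>\<close>, where \<open>n\<close> is the degree of \<open>f\<close>, so of two consecutive
  terms of the progression at most one has such a divisor (Granville).
\<close>

hide_const (open) Polynomials.degree Polynomials.lead_coeff up_ring.coeff up_ring.monom
  Divisibility.prime Divisibility.irreducible Coset.order Formal_Power_Series.radical

section \<open>Belyi maps over the rationals\<close>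

text \<open>If \<open>q^2\<close> divides \<open>f(x)\<close> for a prime \<open>q\<close>
  comparable with \<open>x\<close>, then \<open>rad f(x)\<close> is at most about
  \<open>x^(n-1)\<close>. For \<open>f\<close> alone abc yields only
  \<open>x^(n-1-\<epsilon>)\<close>, which just fails to contradict this. For
  \<open>f(x) f(x+A)\<close> two such divisors push the radical down to about
  \<open>x^(2n-2)\<close>, well below \<open>x^(2n-1-\<epsilon>)\<close>. Hence large primes are
  excluded on consecutive pairs of terms, and about half of the terms may be lost to them; the
  remaining primes must cost clearly less than the other half. The obstacle for the residue of
  \<open>d\<close> is that choosing \<open>x\<close> modulo \<open>p\<close> fixes only
  \<open>d * y^2\<close>. The square part has to be prescribed as well, and it can only contain
  primes modulo which \<open>f\<close> has a root. Such a \<open>y0\<close> is split off by solving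
  \<open>f(x) = y0^2\<close> modulo \<open>y0^3\<close> instead of \<open>f(x) = 0\<close> modulo
  \<open>y0^2\<close>: the quotient is then 1 modulo \<open>y0\<close>, so no further factor of
  \<open>y0\<close> remains in \<open>d\<close>.\<close>

lemma underdetermined_system_nontrivial_solution:
  fixes a :: "nat \<Rightarrow> nat \<Rightarrow> 'a::field"
  assumes "m < n"
  shows "\<exists>x. (\<exists>j<n. x j \<noteq> 0) \<and> (\<forall>i<m. (\<Sum>j<n. a i j * x j) = 0)"
  using assms
proof (induction m arbitrary: n a)
  case 0
  then show ?case by (intro exI[of _ "\<lambda>_. 1"]) auto
next
  case (Suc m)
  show ?case
  proof (cases "\<forall>j<n. a m j = 0")
    case True
    from Suc.IH[of n a] Suc.prems obtain x where x: "\<exists>j<n. x j \<noteq> 0" "\<forall>i<m. (\<Sum>j<n. a i j * x j) = 0" by auto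
    have "(\<Sum>j<n. a m j * x j) = 0" using True by auto
    with x show ?thesis by (intro exI[of _ x]) (auto simp: less_Suc_eq)
  next
    case False
    then obtain k where k: "k < n" "a m k \<noteq> 0" by blast
    obtain n' where n': "n = Suc n'" using Suc.prems by (cases n) auto
    define \<sigma> where "\<sigma> j = (if j < k then j else Suc j)" for j
    have \<sigma>: "bij_betw \<sigma> {..<n'} ({..<n} - {k})"
    proof (rule bij_betwI[where g = "\<lambda>j. if j < k then j else j - 1"])
    qed (use k n' in \<open>auto simp: \<sigma>_def split: if_splits\<close>)
    define b where "b i j = a i (\<sigma> j) - a i k * a m (\<sigma> j) / a m k" for i j
    from Suc.IH[of n' b] Suc.prems n' obtain x where
      x: "\<exists>j<n'. x j \<noteq> 0" "\<forall>i<m. (\<Sum>j<n'. b i j * x j) = 0" by auto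
    define \<tau> where "\<tau> j = (if j < k then j else j - 1)" for j
    have \<tau>: "\<tau> (\<sigma> j) = j" for j by (auto simp: \<tau>_def \<sigma>_def)
    define s where "s = (\<Sum>j<n'. a m (\<sigma> j) * x j)"
    define y where "y j = (if j = k then - s / a m k else x (\<tau> j))" for j
    have \<sigma>k: "\<sigma> j \<noteq> k" for j by (auto simp: \<sigma>_def)
    have y\<sigma>: "y (\<sigma> j) = x j" for j using \<sigma>k by (simp add: y_def \<tau>)
    have sum: "(\<Sum>j<n. a i j * y j) = a i k * y k + (\<Sum>j<n'. a i (\<sigma> j) * x j)" for i
    proof -
      have "(\<Sum>j<n. a i j * y j) = a i k * y k + (\<Sum>j\<in>{..<n} - {k}. a i j * y j)"
        using k by (intro sum.remove) auto
      also have "(\<Sum>j\<in>{..<n} - {k}. a i j * y j) = (\<Sum>j<n'. a i (\<sigma> j) * y (\<sigma> j))"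
        by (rule sum.reindex_bij_betw[OF \<sigma>, symmetric])
      finally show ?thesis by (simp add: y\<sigma>)
    qed
    have "(\<Sum>j<n. a i j * y j) = 0" if "i < Suc m" for i
    proof (cases "i = m")
      case True
      then show ?thesis using k unfolding sum by (simp add: y_def flip: s_def)
    next
      case False
      with that have "(\<Sum>j<n'. b i j * x j) = 0" using x by auto
      then have "(\<Sum>j<n'. a i (\<sigma> j) * x j) - a i k / a m k * s = 0"
        by (simp add: b_def s_def algebra_simps sum_subtractf sum_distrib_left)
      then show ?thesis unfolding sum by (simp add: y_def algebra_simps)
    qed
    moreover obtain j where "j < n'" "x j \<noteq> 0" using x by auto
    then have "\<sigma> j < n" "y (\<sigma> j) \<noteq> 0" using \<sigma> by (auto simp: y\<sigma> bij_betw_def)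
    ultimately show ?thesis by blast
  qed
qed

text \<open>For polynomials over a field this says that every root of \<open>a\<close> in an
  algebraic closure is a root of \<open>b\<close>. Divisibility of some power expresses it over the
  ground field, without closures or multiplicities.\<close>

definition dvd_some_power :: "'a::comm_semiring_1 \<Rightarrow> 'a \<Rightarrow> bool" where
  "dvd_some_power a b \<longleftrightarrow> (\<exists>N. a dvd b ^ N)"

lemma dvd_some_powerI: "a dvd b \<Longrightarrow> dvd_some_power a b"
  unfolding dvd_some_power_def by (rule exI[of _ 1]) simp

lemma dvd_some_power_1 [simp]: "dvd_some_power 1 b"
  by (simp add: dvd_some_power_def)

lemma dvd_some_power_mult:
  assumes "dvd_some_power a c" "dvd_some_power b c"
  shows "dvd_some_power (a * b) c"
  using assms unfolding dvd_some_power_def by (metis mult_dvd_mono power_add)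

lemma dvd_some_power_power:
  "dvd_some_power a c \<Longrightarrow> dvd_some_power (a ^ n) c"
  by (induction n) (auto intro: dvd_some_power_mult)

lemma dvd_some_power_prod:
  "(\<And>x. x \<in> A \<Longrightarrow> dvd_some_power (f x) c) \<Longrightarrow> dvd_some_power (prod f A) c"
  by (induction A rule: infinite_finite_induct) (auto intro: dvd_some_power_mult)

lemma pcompose_power: "pcompose (p ^ n) q = pcompose p q ^ n"
  for p q :: "'a::comm_semiring_1 poly"
  by (induction n) (auto simp: pcompose_mult pcompose_1)

lemma pcompose_dvd_pcompose:
  fixes p q r :: "'a::comm_semiring_1 poly"
  assumes "p dvd q" shows "pcompose p r dvd pcompose q r"
  using assms by (auto simp: dvd_def pcompose_mult)

lemma dvd_some_power_pcompose:
  fixes p q r :: "'a::comm_semiring_1 poly"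
  assumes "dvd_some_power p q" shows "dvd_some_power (pcompose p r) (pcompose q r)"
  using assms pcompose_dvd_pcompose unfolding dvd_some_power_def by (metis pcompose_power)

text \<open>
  The divisibilities say that the roots of \<open>F\<close> and the critical points of \<open>G\<close> are all mapped to \<open>0\<close> or \<open>1\<close>.
\<close>

definition belyi :: "rat poly \<Rightarrow> rat poly \<Rightarrow> bool" where
  "belyi F G \<longleftrightarrow> degree G > 0 \<and> dvd_some_power F (G * (G - 1)) \<and>
     dvd_some_power (pderiv G) (G * (G - 1))"

lemma linear_dvd_diff_const: "[:-s, 1:] dvd T - [:poly T s:]" for s :: "'a::comm_ring_1"
  by (simp add: poly_eq_0_iff_dvd[symmetric])

text \<open>By the chain rule the critical points of the composition are those of \<open>T\<close>
  and the preimages under \<open>T\<close> of those of \<open>G\<close>. \<open>T\<close> sends the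
  former, and the roots of \<open>P\<close>, to roots of \<open>F\<close>, which \<open>G\<close>
  sends to 0 or 1.\<close>

lemma belyi_pcompose:
  assumes G: "belyi F G" and "degree T > 0"
    and P: "dvd_some_power P (pcompose F T)" and T': "dvd_some_power (pderiv T) (pcompose F T)"
  shows "belyi P (pcompose G T)"
proof -
  define Q where "Q = pcompose G T * (pcompose G T - 1)"
  have Q: "pcompose (G * (G - 1)) T = Q" by (simp add: Q_def pcompose_mult pcompose_diff pcompose_1)
  have F: "dvd_some_power (pcompose F T) Q" and G': "dvd_some_power (pcompose (pderiv G) T) Q"
    using dvd_some_power_pcompose[of _ "G * (G - 1)" T] G unfolding Q belyi_def by auto
  have trans: "dvd_some_power a Q" if "dvd_some_power a (pcompose F T)" for a
    using that F unfolding dvd_some_power_def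
    by (metis dvd_power_same dvd_trans power_mult)
  have "degree (pcompose G T) > 0" using G assms(2) by (simp add: belyi_def)
  moreover have "dvd_some_power (pderiv (pcompose G T)) Q"
    unfolding pderiv_pcompose using G' trans[OF T'] by (rule dvd_some_power_mult)
  ultimately show ?thesis using trans[OF P] by (simp add: belyi_def Q_def)
qed

text \<open>
  After an affine change of variables the extreme points are \<open>0\<close>, \<open>1\<close> and some other point is \<open>m / (m + n)\<close>,
  which is the only new critical point of \<open>x\<^sup>m (1 - x)\<^sup>n\<close>; this map identifies \<open>0\<close> with \<open>1\<close>.
\<close>

lemma ex_belyi_rational_roots:
  fixes S :: "rat set"
  assumes "finite S"
  shows "\<exists>G. belyi (\<Prod>s\<in>S. [:-s, 1:]) G"
  using assms
proof (induction "card S" arbitrary: S rule: less_induct)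
  case less
  show ?case
  proof (cases "\<exists>u v. u < v \<and> S \<subseteq> {u, v}")
    case True
    then obtain u v where uv: "u < v" "S \<subseteq> {u, v}" by blast
    define G where "G = [:-u / (v - u), 1 / (v - u):]"
    have G: "G = smult (1 / (v - u)) [:-u, 1:]" "G - 1 = smult (1 / (v - u)) [:-v, 1:]"
      using uv by (auto simp: G_def one_pCons field_simps)
    have "[:-u, 1:] dvd G" "[:-v, 1:] dvd G - 1"
      by (subst G, simp only: dvd_smult dvd_refl)+
    then have "dvd_some_power [:-s, 1:] (G * (G - 1))" if "s \<in> S" for s
      using that uv by (intro dvd_some_powerI) (auto intro: dvd_mult dvd_mult2)
    moreover have "dvd_some_power (pderiv G) (G * (G - 1))"
      by (rule dvd_some_powerI, rule unit_imp_dvd) (use uv in \<open>auto simp: G_def pderiv_pCons is_unit_iff_degree\<close>)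
    moreover have "degree G > 0" using uv by (simp add: G_def)
    ultimately have "belyi (\<Prod>s\<in>S. [:-s, 1:]) G"
      by (auto simp: belyi_def intro!: dvd_some_power_prod)
    then show ?thesis by blast
  next
    case False
    have ne: "S \<noteq> {}" using False[simplified, rule_format, of 0 1] by auto
    define u where "u = Min S"
    define v where "v = Max S"
    have uS: "u \<in> S" and vS: "v \<in> S" and bd: "\<And>s. s \<in> S \<Longrightarrow> u \<le> s \<and> s \<le> v"
      using less.prems ne by (auto simp: u_def v_def)
    have "u < v"
    proof (rule ccontr)
      assume "\<not> u < v"
      then have "S \<subseteq> {u, u + 1}" using bd by force
      with False show False by (metis less_add_one)
    qed
    then obtain w where w: "w \<in> S" "w \<noteq> u" "w \<noteq> v" using False by blast
    then have uwv: "u < w" "w < v" using bd[of w] by auto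
    define l where "l = (w - u) / (v - u)"
    have l: "0 < l" "l < 1" using uwv by (auto simp: l_def)
    obtain a c where ac: "quotient_of l = (a, c)" by (cases "quotient_of l")
    then have c: "c > 0" "l = of_int a / of_int c" using quotient_of_denom_pos quotient_of_div by blast+
    from l c have "0 < a" "a < c" by (auto simp: field_simps)
    define m n where "m = nat a" and "n = nat (c - a)"
    have mn: "m > 0" "n > 0" using \<open>0 < a\<close> \<open>a < c\<close> by (auto simp: m_def n_def)
    have lmn: "l * (of_nat m + of_nat n) = of_nat m"
      using c \<open>0 < a\<close> \<open>a < c\<close> by (simp add: m_def n_def of_nat_nat)
    define L where "L = [:-u / (v - u), 1 / (v - u):]"
    have L: "L = smult (1 / (v - u)) [:-u, 1:]" "1 - L = smult (- 1 / (v - u)) [:-v, 1:]"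
      using \<open>u < v\<close> by (auto simp: L_def one_pCons field_simps)
    \<comment> \<open>\<open>L\<close> sends \<open>w\<close> to \<open>m / (m + n)\<close>, so this
      factor of \<open>pderiv T\<close> is a multiple of \<open>x - w\<close>. All critical points
      of \<open>T\<close> are thus among \<open>u\<close>, \<open>v\<close>, \<open>w\<close> and
      already belong to \<open>S\<close>.\<close>
    have Lw: "[:of_nat m:] - smult (of_nat m + of_nat n) L = smult (- (of_nat m + of_nat n) / (v - u)) [:-w, 1:]"
      using \<open>u < v\<close> lmn unfolding l_def
      by (auto simp: L_def field_simps)
    define T where "T = L ^ m * (1 - L) ^ n"
    have degL: "degree L = 1" "degree (1 - L) = 1"
      using \<open>u < v\<close> by (simp add: L_def, subst L(2), simp)
    have L0: "L \<noteq> 0" "1 - L \<noteq> 0" using degL by auto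
    have degT: "degree T > 0" using mn L0 by (simp add: T_def degree_mult_eq degree_power_eq degL)
    obtain m' n' where mn': "m = Suc m'" "n = Suc n'" using mn by (metis Suc_pred)
    have pT: "pderiv T = smult (1 / (v - u)) (L ^ m' * (1 - L) ^ n' * ([:of_nat m:] - smult (of_nat m + of_nat n) L))"
    proof -
      have ring_eq: "l * x * (b * (y * - k)) + (1 - l) * y * (a * (x * k)) = k * (x * y * (a * (1 - l) - b * l))"
        for l x b y k a :: "rat poly" by (simp add: algebra_simps)
      have "pderiv L = [:1 / (v - u):]" by (simp add: L_def pderiv_pCons)
      moreover have "pderiv (1 - L) = [:- 1 / (v - u):]" by (simp add: pderiv_diff calculation)
      ultimately have "pderiv T = L * L ^ m' * ([:of_nat n:] * ((1 - L) ^ n' * - [:1 / (v - u):])) +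
          (1 - L) * (1 - L) ^ n' * ([:of_nat m:] * (L ^ m' * [:1 / (v - u):]))"
        unfolding T_def pderiv_mult mn' pderiv_power_Suc by simp
      also have "\<dots> = [:1 / (v - u):] * (L ^ m' * (1 - L) ^ n' * ([:of_nat m:] * (1 - L) - [:of_nat n:] * L))"
        using ring_eq[of L "L ^ m'" "[:of_nat n:]" "(1 - L) ^ n'" "[:1 / (v - u):]" "[:of_nat m:]"] .
      also have "\<dots> = smult (1 / (v - u)) (L ^ m' * (1 - L) ^ n' * (smult (of_nat m) (1 - L) - smult (of_nat n) L))"
        by simp
      also have "smult (of_nat m) (1 - L) - smult (of_nat n) L = [:of_nat m:] - smult (of_nat m + of_nat n) L"
        by (simp add: smult_add_left smult_diff_right one_pCons algebra_simps)
      finally show ?thesis .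
    qed
    have T0: "poly T u = 0" "poly T v = 0" using mn \<open>u < v\<close> by (auto simp: T_def L_def field_simps)
    have "poly T ` S = poly T ` (S - {v})" using T0 uS \<open>u < v\<close> by (auto simp: image_iff) (metis DiffI empty_iff insert_iff less_irrefl)
    then have "card (poly T ` S) < card S"
      using less.prems vS by (metis card_Diff1_less card_image_le finite_Diff le_less_trans)
    from less.hyps[OF this] less.prems obtain G where G: "belyi (\<Prod>s\<in>poly T ` S. [:-s, 1:]) G" by auto
    define F where "F = pcompose (\<Prod>s\<in>poly T ` S. [:-s, 1:]) T"
    have F: "[:-s, 1:] dvd F" if "s \<in> S" for s
    proof -
      have "pcompose [:-poly T s, 1:] T dvd F" unfolding F_def
        using that less.prems by (intro pcompose_dvd_pcompose dvd_prodI) auto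
      moreover have "pcompose [:-poly T s, 1:] T = T - [:poly T s:]"
        by (simp add: pcompose_pCons)
      ultimately show ?thesis using linear_dvd_diff_const dvd_trans by metis
    qed
    have ds: "dvd_some_power (smult k [:-s, 1:]) F" if "s \<in> S" "k \<noteq> 0" for s k
      using F[OF that(1)] that(2) by (intro dvd_some_powerI) (simp only: smult_dvd_iff if_False)
    have "dvd_some_power (smult (1 / (v - u)) (L ^ m' * (1 - L) ^ n' * ([:of_nat m:] - smult (of_nat m + of_nat n) L))) F"
    proof -
      have "dvd_some_power L F" "dvd_some_power (1 - L) F"
        using \<open>u < v\<close> uS vS by (subst L, intro ds; simp)+
      moreover have "dvd_some_power ([:of_nat m:] - smult (of_nat m + of_nat n) L) F"
        unfolding Lw using \<open>u < v\<close> mn w by (intro ds) (auto simp: add_nonneg_eq_0_iff)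
      ultimately have "dvd_some_power (L ^ m' * (1 - L) ^ n' * ([:of_nat m:] - smult (of_nat m + of_nat n) L)) F"
        by (intro dvd_some_power_mult dvd_some_power_power)
      then show ?thesis using \<open>u < v\<close> by (auto simp: dvd_some_power_def smult_dvd_iff)
    qed
    then have "dvd_some_power (pderiv T) F" unfolding pT .
    moreover have "dvd_some_power (\<Prod>s\<in>S. [:-s, 1:]) F"
      using F by (blast intro: dvd_some_power_prod dvd_some_powerI)
    ultimately have "belyi (\<Prod>s\<in>S. [:-s, 1:]) (pcompose G T)"
      unfolding F_def by (intro belyi_pcompose[OF G degT])
    then show ?thesis by blast
  qed
qed

text \<open>With \<open>k = degree T\<close>, the \<open>k\<close> powers
  \<open>T^0, ..., T^(k-1)\<close> are linearly dependent modulo \<open>pderiv T\<close>, because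
  the residues form a space of dimension \<open>k - 1\<close>. The coefficients of a dependence form
  \<open>R\<close>; its conclusion says that all critical values of \<open>T\<close> are roots of
  \<open>R\<close>.\<close>

lemma ex_annihilator_of_critical_values:
  fixes T :: "'a::field_char_0 poly"
  assumes "degree T > 0"
  shows "\<exists>R. R \<noteq> 0 \<and> degree R < degree T \<and> pderiv T dvd pcompose R T"
proof -
  define k where "k = degree T"
  have T': "pderiv T \<noteq> 0" "degree (pderiv T) = k - 1" using assms by (auto simp: k_def pderiv_eq_0_iff degree_pderiv)
  obtain x where x: "\<exists>j<k. x j \<noteq> 0"
      "\<forall>i<k-1. (\<Sum>j<k. coeff (T ^ j mod pderiv T) i * x j) = 0"
    using underdetermined_system_nontrivial_solution[of "k - 1" k "\<lambda>i j. coeff (T ^ j mod pderiv T) i"] assms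
    unfolding k_def by auto
  define R where "R = (\<Sum>j<k. monom (x j) j)"
  have cR: "coeff R j = (if j < k then x j else 0)" for j
    by (auto simp: R_def coeff_sum coeff_monom sum.delta' if_distrib cong: if_cong)
  have "R \<noteq> 0" using x cR by (metis coeff_0)
  moreover have "degree R < k"
    using assms by (intro degree_lessI) (auto simp: cR k_def)
  moreover have "pderiv T dvd pcompose R T"
  proof -
    have "pcompose R T = (\<Sum>j<k. smult (x j) (T ^ j))"
      by (simp add: R_def pcompose_sum monom_altdef pcompose_smult pcompose_power pcompose_pCons)
    also have "\<dots> = (\<Sum>j<k. smult (x j) (T ^ j mod pderiv T)) + pderiv T * (\<Sum>j<k. smult (x j) (T ^ j div pderiv T))"
      unfolding sum_distrib_left sum.distrib[symmetric]
      by (intro sum.cong refl) (metis add.commute mult.commute div_mult_mod_eq mult_smult_right smult_add_right)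
    also have "(\<Sum>j<k. smult (x j) (T ^ j mod pderiv T)) = 0"
    proof (rule poly_eqI)
      fix i
      show "coeff (\<Sum>j<k. smult (x j) (T ^ j mod pderiv T)) i = coeff 0 i"
      proof (cases "i < k - 1")
        case True
        then show ?thesis using x(2) by (simp add: coeff_sum mult.commute)
      next
        case False
        have "coeff (T ^ j mod pderiv T) i = 0" for j
        proof -
          have "T ^ j mod pderiv T = 0 \<or> degree (T ^ j mod pderiv T) < k - 1"
            using degree_mod_less[of "pderiv T" "T ^ j"] T' by auto
          then show ?thesis using False by (auto intro: coeff_eq_0)
        qed
        then show ?thesis by (simp add: coeff_sum)
      qed
    qed
    finally show ?thesis by simp
  qed
  ultimately show ?thesis unfolding k_def by blast
qed

text \<open>
  Applying \<open>T\<close> to its own roots leaves only its critical values, which are roots of a polynomial of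
  smaller degree, and rational points.
\<close>

lemma ex_belyi_mult_rational_roots:
  fixes T :: "rat poly" and S :: "rat set"
  assumes "T \<noteq> 0" "finite S"
  shows "\<exists>G. belyi (T * (\<Prod>s\<in>S. [:-s, 1:])) G"
  using assms
proof (induction "degree T" arbitrary: T S rule: less_induct)
  case less
  show ?case
  proof (cases "degree T = 0")
    case True
    with less.prems have "T dvd 1" by (simp add: is_unit_iff_degree)
    obtain G where "belyi (\<Prod>s\<in>S. [:-s, 1:]) G" using ex_belyi_rational_roots less.prems by blast
    then have "belyi (T * (\<Prod>s\<in>S. [:-s, 1:])) G" unfolding belyi_def
      using \<open>T dvd 1\<close> by (metis dvd_some_power_def dvd_some_power_mult power_0)
    then show ?thesis by blast
  next
    case False
    then obtain R where R: "R \<noteq> 0" "degree R < degree T" "pderiv T dvd pcompose R T"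
      using ex_annihilator_of_critical_values by blast
    \<comment> \<open>The point 0 is added because \<open>T\<close> sends its own roots
      there.\<close>
    define S' where "S' = insert 0 (poly T ` S)"
    have fin: "finite S'" using less.prems by (simp add: S'_def)
    from less.hyps[OF R(2) R(1) fin] obtain G where G: "belyi (R * (\<Prod>s\<in>S'. [:-s, 1:])) G" by blast
    define F where "F = pcompose (R * (\<Prod>s\<in>S'. [:-s, 1:])) T"
    have F: "T - [:s:] dvd F" if "s \<in> S'" for s
    proof -
      have "pcompose [:-s, 1:] T dvd F" unfolding F_def
        using that fin by (intro pcompose_dvd_pcompose dvd_mult dvd_prodI) auto
      moreover have "pcompose [:-s, 1:] T = T - [:s:]" by (simp add: pcompose_pCons)
      ultimately show ?thesis by metis
    qed
    have "T dvd F" using F[of 0] by (simp add: S'_def)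
    moreover have "[:-s, 1:] dvd F" if "s \<in> S" for s
      using F[of "poly T s"] linear_dvd_diff_const[of s T] that dvd_trans by (auto simp: S'_def)
    moreover have "pderiv T dvd F" using R(3) by (simp add: F_def pcompose_mult)
    ultimately have "dvd_some_power T F" "\<And>s. s \<in> S \<Longrightarrow> dvd_some_power [:-s, 1:] F"
        "dvd_some_power (pderiv T) F"
      by (blast intro: dvd_some_powerI)+
    then have "dvd_some_power (T * (\<Prod>s\<in>S. [:-s, 1:])) F" "dvd_some_power (pderiv T) F"
      by (blast intro: dvd_some_power_mult dvd_some_power_prod)+
    then have "belyi (T * (\<Prod>s\<in>S. [:-s, 1:])) (pcompose G T)"
      using False by (intro belyi_pcompose[OF G]) (auto simp: F_def)
    then show ?thesis by blast
  qed
qed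

lemma ex_belyi: "F \<noteq> 0 \<Longrightarrow> \<exists>G. belyi F G"
  using ex_belyi_mult_rational_roots[of F "{}"] by simp

section \<open>Radicals of polynomial values under abc\<close>

text \<open>Write \<open>A = q^e s\<close> with \<open>q\<close> not dividing \<open>s\<close>.
  Modulo \<open>q^e\<close> the derivative is \<open>e q^(e-1) q' s\<close>, and \<open>q\<close>
  does not divide \<open>q'\<close>, which is nonzero in characteristic 0 and of smaller
  degree.\<close>

lemma not_prime_power_multiplicity_dvd_pderiv:
  fixes A q :: "rat poly"
  assumes "prime q" "q dvd A" "A \<noteq> 0"
  shows "\<not> q ^ multiplicity q A dvd pderiv A"
proof
  assume dvd: "q ^ multiplicity q A dvd pderiv A"
  define e where "e = multiplicity q A"
  have q: "\<not> is_unit q" "q \<noteq> 0" using assms(1) by (metis not_prime_unit, metis not_prime_0)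
  have "e \<noteq> 0" using multiplicity_eq_zero_iff[OF assms(3) q(1)] assms(2) by (simp add: e_def)
  then obtain e' where e': "e = Suc e'" by (cases e) auto
  obtain s where s: "A = q ^ e * s" "\<not> q dvd s"
    using multiplicity_decompose'[OF assms(3) q(1)] unfolding e_def by metis
  have "pderiv A = q ^ e * pderiv s + q ^ e' * (smult (of_nat e) (pderiv q * s))"
    unfolding s(1) pderiv_mult e' pderiv_power_Suc by (simp add: algebra_simps)
  then have "q ^ e' * q dvd q ^ e' * (smult (of_nat e) (pderiv q * s))"
    using dvd unfolding e_def[symmetric] e' by (simp add: dvd_add_right_iff mult.commute)
  then have "q dvd smult (of_nat e) (pderiv q * s)"
    using q dvd_times_left_cancel_iff[of "q ^ e'" q] by (metis power_not_zero)
  then have "q dvd pderiv q * s" using \<open>e \<noteq> 0\<close> dvd_smult_iff by (metis of_nat_eq_0_iff)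
  then have "q dvd pderiv q" using s(2) assms(1) by (simp add: prime_dvd_mult_iff)
  moreover have "degree q > 0" using q by (auto simp: is_unit_iff_degree)
  moreover have "pderiv q \<noteq> 0" using \<open>degree q > 0\<close> by (simp add: pderiv_eq_0_iff)
  ultimately show False using dvd_imp_degree_le[of q "pderiv q"] by (simp add: degree_pderiv)
qed

text \<open>This is the Riemann-Hurwitz count. Split \<open>P = G (G - 1)\<close>, of degree
  \<open>2 * degree G\<close>, into its radical \<open>V\<close> and the rest \<open>W\<close>. All
  critical points lie over 0 and 1, where differentiation lowers multiplicities, so
  \<open>pderiv G\<close> divides \<open>W\<close> and \<open>degree V \<le> degree G + 1\<close>.
  As \<open>F\<close> is squarefree it divides \<open>V\<close>, and \<open>H\<close> is the
  quotient.\<close>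

lemma belyi_radical_cofactor:
  assumes "belyi F G" "squarefree F"
  shows "\<exists>H. H \<noteq> 0 \<and> degree F + degree H \<le> degree G + 1 \<and> dvd_some_power (G * (G - 1)) (F * H)"
proof -
  define P where "P = G * (G - 1)"
  have degG: "degree G > 0" using assms by (simp add: belyi_def)
  have "degree (G - 1) = degree G" using degG degree_add_eq_left[of "- 1" G] by simp
  moreover from this have G0: "G \<noteq> 0" "G - 1 \<noteq> 0" using degG by auto
  ultimately have P0: "P \<noteq> 0" "degree P = 2 * degree G" by (auto simp: P_def degree_mult_eq)
  define V where "V = \<Prod>(prime_factors P)"
  define W where "W = (\<Prod>q\<in>prime_factors P. q ^ (multiplicity q P - 1))"
  have fin: "finite (prime_factors P)" by simp
  have VW: "V * W = normalize P"
  proof -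
    have "V * W = (\<Prod>q\<in>prime_factors P. q ^ multiplicity q P)" unfolding V_def W_def prod.distrib[symmetric]
    proof (intro prod.cong refl)
      fix q assume "q \<in> prime_factors P"
      then have "multiplicity q P > 0" by (simp add: prime_factors_multiplicity)
      then show "q * q ^ (multiplicity q P - 1) = q ^ multiplicity q P" by (simp add: power_eq_if)
    qed
    then show ?thesis using P0 by (simp add: prod_prime_factors)
  qed
  have VW0: "V \<noteq> 0" "W \<noteq> 0" using VW P0 by auto
  have PV: "dvd_some_power P V"
  proof -
    have "dvd_some_power (\<Prod>q\<in>prime_factors P. q ^ multiplicity q P) V"
      by (intro dvd_some_power_prod dvd_some_power_power dvd_some_powerI) (auto simp: V_def intro: dvd_prodI)
    then show ?thesis using P0 by (simp add: prod_prime_factors dvd_some_power_def)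
  qed
  have sub: "prime_factors A \<subseteq> prime_factors P" if "dvd_some_power A P" for A
  proof
    fix q assume q: "q \<in> prime_factors A"
    from that obtain N where "A dvd P ^ N" by (auto simp: dvd_some_power_def)
    with q have "prime q" "q dvd P ^ N" by (auto dest: dvd_trans in_prime_factors_imp_dvd)
    then show "q \<in> prime_factors P" using P0 by (auto simp: prime_factors_dvd dest: prime_dvd_power)
  qed
  have "F dvd V"
  proof -
    have F0: "F \<noteq> 0" using assms by auto
    have "normalize F = (\<Prod>q\<in>prime_factors F. q ^ multiplicity q F)" using F0 by (simp add: prod_prime_factors)
    also have "\<dots> = \<Prod>(prime_factors F)"
      using assms(2) F0 by (intro prod.cong refl) (auto simp: squarefree_factorial_semiring')
    also have "\<dots> dvd V" unfolding V_def using sub[of F] assms(1) 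
      by (intro prod_dvd_prod_subset) (auto simp: belyi_def P_def)
    finally show ?thesis by simp
  qed
  then obtain H where H: "V = F * H" by blast
  have "pderiv G dvd W"
  proof (rule multiplicity_le_imp_dvd)
    show G'0: "pderiv G \<noteq> 0" using degG by (simp add: pderiv_eq_0_iff)
    fix q :: "rat poly" assume q: "prime q"
    show "multiplicity q (pderiv G) \<le> multiplicity q W"
    proof (cases "q dvd pderiv G")
      case False
      then show ?thesis by (simp add: not_dvd_imp_multiplicity_0)
    next
      case True
      then have "q \<in> prime_factors P" using sub[of "pderiv G"] assms(1) q G'0
        by (auto simp: belyi_def P_def prime_factors_dvd)
      then have qP: "q dvd G * (G - 1)" and W: "q ^ (multiplicity q P - 1) dvd W"
        by (auto simp: P_def[symmetric] W_def intro: dvd_prodI)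
      have cop: "\<not> (q dvd G \<and> q dvd G - 1)"
      proof
        assume "q dvd G \<and> q dvd G - 1"
        then have "q dvd G - (G - 1)" by (blast intro: dvd_diff)
        also have "G - (G - 1) = 1" by simp
        finally show False using q not_prime_unit by blast
      qed
      have mP: "multiplicity q P = multiplicity q G + multiplicity q (G - 1)"
        unfolding P_def using q G0 by (intro prime_elem_multiplicity_mult_distrib) auto
      have "\<not> q ^ multiplicity q P dvd pderiv G"
      proof (cases "q dvd G")
        case True
        then have "multiplicity q (G - 1) = 0" using cop by (simp add: not_dvd_imp_multiplicity_0)
        then show ?thesis using not_prime_power_multiplicity_dvd_pderiv[OF q True G0(1)] mP by simp
      next
        case False
        then have "q dvd G - 1" "multiplicity q G = 0"
          using qP q by (auto simp: prime_dvd_mult_iff not_dvd_imp_multiplicity_0)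
        then show ?thesis using not_prime_power_multiplicity_dvd_pderiv[OF q _ G0(2)] mP 
          by (simp add: pderiv_diff)
      qed
      then have "multiplicity q (pderiv G) < multiplicity q P"
        using multiplicity_dvd' by (meson not_less)
      then have "multiplicity q (pderiv G) \<le> multiplicity q P - 1" by simp
      also have "\<dots> \<le> multiplicity q W"
        using W VW0 q not_prime_unit by (intro multiplicity_geI) blast+
      finally show ?thesis .
    qed
  qed
  then have "degree G - 1 \<le> degree W" using VW0 dvd_imp_degree_le[of "pderiv G" W] by (simp add: degree_pderiv)
  moreover have "degree V + degree W = 2 * degree G"
  proof -
    have "degree V + degree W = degree (normalize P)" using VW VW0 by (metis degree_mult_eq)
    also have "\<dots> = degree P" using P0(1) by (intro antisym dvd_imp_degree_le) auto
    finally show ?thesis using P0(2) by simp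
  qed
  ultimately have "degree V \<le> degree G + 1" using degG by simp
  moreover have "F \<noteq> 0" "H \<noteq> 0" using H VW0 by auto
  ultimately show ?thesis using PV unfolding P_def H by (auto simp: degree_mult_eq)
qed

text \<open>Exchanging the values 0 and 1 flips the sign of the leading coefficient, so that it may
  be taken positive.\<close>

lemma belyi_one_minus:
  assumes "belyi F G" shows "belyi F (1 - G)" "lead_coeff (1 - G) = - lead_coeff G" "degree (1 - G) = degree G"
proof -
  have d: "degree G > 0" using assms by (simp add: belyi_def)
  have "(1 - G) * (1 - G - 1) = G * (G - 1)" by (simp add: algebra_simps)
  moreover show "degree (1 - G) = degree G" using d using degree_add_eq_right[of 1 "- G"] by simp
  moreover have "pderiv (1 - G) = - pderiv G" by (simp add: pderiv_diff)
  ultimately show "belyi F (1 - G)" using assms by (simp add: belyi_def dvd_some_power_def)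
  show "lead_coeff (1 - G) = - lead_coeff G"
    using d \<open>degree (1 - G) = degree G\<close> by simp
qed

section \<open>Belyi polynomials with integer coefficients\<close>

lemma rat_poly_clear_denominators:
  fixes P :: "rat poly"
  shows "\<exists>c p. c > 0 \<and> smult (of_int c) P = map_poly of_int p"
proof (induction P)
  case 0
  show ?case by (intro exI[of _ 1] exI[of _ 0]) simp
next
  case (pCons a P)
  then obtain c p where cp: "c > 0" "smult (of_int c) P = map_poly of_int p" by blast
  obtain x y where q: "quotient_of a = (x, y)" by (cases "quotient_of a")
  then have y: "y > 0" "a = of_int x / of_int y" using quotient_of_denom_pos quotient_of_div by blast+
  have "smult (of_int (c * y)) (pCons a P) = pCons (of_int (c * x)) (smult (of_int y) (smult (of_int c) P))"
    using y by (simp add: mult.commute)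
  also have "\<dots> = map_poly of_int (pCons (c * x) (smult y p))"
    unfolding cp(2) by (simp add: hom_distribs)
  finally show ?case using cp y by (intro exI[of _ "c * y"] exI[of _ "pCons (c * x) (smult y p)"]) simp
qed

text \<open>Clearing denominators by \<open>g = M G\<close> moves the special values 0 and 1 to 0
  and \<open>M\<close>. At an integer, \<open>M + (g - M) = g\<close> is then an equation for abc
  whose primes divide \<open>M\<close>, \<open>E\<close>, \<open>F\<close> or \<open>H\<close>;
  \<open>E\<close> collects the constants left over from the denominators.\<close>

lemma ex_int_belyi:
  fixes F :: "int poly"
  assumes "squarefree (map_poly of_int F :: rat poly)"
  shows "\<exists>g H M E N. degree g > 0 \<and> lead_coeff g > 0 \<and> H \<noteq> 0 \<and> M > 0 \<and> E > 0 \<and>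
           degree F + degree H \<le> degree g + 1 \<and> g * (g - [:M:]) dvd smult E ((F * H) ^ N)"
proof -
  define \<iota> :: "int poly \<Rightarrow> rat poly" where "\<iota> = map_poly of_int"
  have \<iota>: "\<iota> (p * q) = \<iota> p * \<iota> q" "\<iota> (p - q) = \<iota> p - \<iota> q" "\<iota> (p ^ n) = \<iota> p ^ n" "\<iota> (smult c p) = smult (of_int c) (\<iota> p)"
      "\<iota> [:c:] = [:of_int c:]" "\<iota> p = \<iota> q \<longleftrightarrow> p = q" "degree (\<iota> p) = degree p" "lead_coeff (\<iota> p) = of_int (lead_coeff p)"
     for p q n c by (auto simp: \<iota>_def hom_distribs)
  have sf: "squarefree (\<iota> F)" using assms by (simp add: \<iota>_def)
  then have "\<iota> F \<noteq> 0" by auto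
  then obtain G0 where G0: "belyi (\<iota> F) G0" using ex_belyi by blast
  have "G0 \<noteq> 0" using G0 by (auto simp: belyi_def)
  then have "lead_coeff G0 > 0 \<or> lead_coeff (1 - G0) > 0" using belyi_one_minus[OF G0]
    by (metis leading_coeff_0_iff neg_0_less_iff_less not_less_iff_gr_or_eq)
  then obtain G where G: "belyi (\<iota> F) G" "lead_coeff G > 0" using G0 belyi_one_minus by blast
  obtain H where H: "H \<noteq> 0" "degree F + degree H \<le> degree G + 1" "dvd_some_power (G * (G - 1)) (\<iota> F * H)"
    using belyi_radical_cofactor[OF G(1) sf] \<iota> by auto
  then obtain N W where W: "(\<iota> F * H) ^ N = G * (G - 1) * W" by (auto simp: dvd_some_power_def elim: dvdE)
  obtain M g where g: "M > 0" "smult (of_int M) G = \<iota> g" using rat_poly_clear_denominators unfolding \<iota>_def by blast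
  obtain c h where h: "c > 0" "smult (of_int c) H = \<iota> h" using rat_poly_clear_denominators unfolding \<iota>_def by blast
  obtain d w where w: "d > 0" "smult (of_int d) W = \<iota> w" using rat_poly_clear_denominators unfolding \<iota>_def by blast
  have degg: "degree g = degree G" using arg_cong[OF g(2), of degree] g(1) by (simp add: \<iota>)
  have degh: "degree h = degree H" using arg_cong[OF h(2), of degree] h(1) by (simp add: \<iota>)
  have "of_int (lead_coeff g) = of_int M * lead_coeff G" 
    using arg_cong[OF g(2), of "\<lambda>p. coeff p (degree g)"] degg by (simp add: \<iota>_def)
  then have lg: "lead_coeff g > 0" using g(1) G(2) by (metis mult_pos_pos of_int_0_less_iff)
  have "\<iota> (g * (g - [:M:])) = smult (of_int M ^ 2) (G * (G - 1))"
  proof -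
    have "\<iota> (g * (g - [:M:])) = smult (of_int M) G * (smult (of_int M) G - smult (of_int M) 1)"
      by (simp add: \<iota> g(2) one_pCons)
    also have "smult (of_int M) G - smult (of_int M) 1 = smult (of_int M) (G - 1)"
      by (simp add: smult_diff_right)
    finally show ?thesis by (simp add: power2_eq_square)
  qed
  then have "\<iota> (smult (c ^ N) (g * (g - [:M:]) * w)) = smult (of_int c ^ N * of_int M ^ 2 * of_int d) (G * (G - 1) * W)"
    by (simp add: \<iota> w(2)[symmetric] mult_ac)
  also have "\<dots> = \<iota> (smult (M ^ 2 * d) ((F * h) ^ N))"
    unfolding W[symmetric] by (simp add: \<iota> h(2)[symmetric] mult_ac smult_power)
  finally have "smult (c ^ N) (g * (g - [:M:]) * w) = smult (M ^ 2 * d) ((F * h) ^ N)" by (simp only: \<iota>(6))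
  then have "g * (g - [:M:]) * smult (c ^ N) w = smult (M ^ 2 * d) ((F * h) ^ N)" by simp
  then have "g * (g - [:M:]) dvd smult (M ^ 2 * d) ((F * h) ^ N)" by (metis dvd_triv_left)
  moreover have "h \<noteq> 0" using h H by (auto simp: \<iota>_def)
  ultimately show ?thesis using lg degg degh g(1) w(1) H(2) G(1)
    by (intro exI[of _ g] exI[of _ h] exI[of _ M] exI[of _ "M ^ 2 * d"] exI[of _ N]) (auto simp: belyi_def)
qed

section \<open>Bounds for radicals and for polynomial values\<close>

lemma radical_le_mult_radical:
  assumes "n > 0" "k > 0" "m > 0" "\<And>q. prime q \<Longrightarrow> q dvd n \<Longrightarrow> q dvd k * m"
  shows "radical n \<le> k * radical m"
proof -
  have "prime_factors n \<subseteq> prime_factors k \<union> prime_factors m"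
    using assms by (auto simp: prime_factors_dvd prime_dvd_mult_iff)
  then have "radical n dvd \<Prod>(prime_factors k \<union> prime_factors m)"
    unfolding radical_def by (intro prod_dvd_prod_subset) auto
  also have "prime_factors k \<union> prime_factors m = (prime_factors k - prime_factors m) \<union> prime_factors m" by auto
  also have "\<Prod>\<dots> = \<Prod>(prime_factors k - prime_factors m) * radical m"
    unfolding radical_def by (intro prod.union_disjoint) auto
  also have "\<dots> dvd k * radical m"
  proof (intro mult_dvd_mono dvd_refl)
    have "\<Prod>(prime_factors k - prime_factors m) dvd \<Prod>(prime_factors k)"
      by (intro prod_dvd_prod_subset) auto
    also have "\<dots> dvd (\<Prod>q\<in>prime_factors k. q ^ multiplicity q k)"
      by (intro prod_dvd_prod) (auto simp: prime_factors_multiplicity dvd_power)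
    also have "\<dots> = k" using assms by (simp add: prod_prime_factors)
    finally show "\<Prod>(prime_factors k - prime_factors m) dvd k" .
  qed
  finally show ?thesis
  proof (rule dvd_imp_le)
    have "radical m > 0" unfolding radical_def by (intro prod_pos) (auto intro: prime_gt_0_nat in_prime_factors_imp_prime)
    then show "0 < k * radical m" using assms by simp
  qed
qed

lemma poly_le_degree_power:
  fixes p :: "int poly"
  shows "\<exists>B>0. \<forall>x\<ge>1. \<bar>poly p (int x)\<bar> \<le> B * int x ^ degree p"
proof (intro exI conjI allI impI)
  show "0 < (\<Sum>i\<le>degree p. \<bar>coeff p i\<bar>) + 1" by (smt (verit) sum_nonneg abs_ge_zero)
  fix x :: nat assume x: "x \<ge> 1"
  have "\<bar>poly p (int x)\<bar> \<le> (\<Sum>i\<le>degree p. \<bar>coeff p i * int x ^ i\<bar>)" unfolding poly_altdef by (rule sum_abs)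
  also have "\<dots> \<le> (\<Sum>i\<le>degree p. \<bar>coeff p i\<bar> * int x ^ degree p)"
    using x by (intro sum_mono) (auto simp: abs_mult intro!: mult_left_mono power_increasing)
  also have "\<dots> \<le> ((\<Sum>i\<le>degree p. \<bar>coeff p i\<bar>) + 1) * int x ^ degree p"
    unfolding sum_distrib_right[symmetric] by (simp add: algebra_simps)
  finally show "\<bar>poly p (int x)\<bar> \<le> ((\<Sum>i\<le>degree p. \<bar>coeff p i\<bar>) + 1) * int x ^ degree p" .
qed

lemma poly_ge_degree_power:
  fixes p :: "int poly"
  assumes "degree p > 0" "lead_coeff p > 0"
  shows "\<exists>X0. \<forall>x\<ge>X0. int x ^ degree p \<le> 2 * poly p (int x)"
proof -
  define D where "D = degree p"
  define r where "r = p - monom (lead_coeff p) D"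
  have "degree r < D"
  proof (rule degree_lessI)
    show "r \<noteq> 0 \<or> 0 < D" using assms by (simp add: D_def)
    show "\<forall>k\<ge>D. coeff r k = 0" by (auto simp: r_def D_def coeff_monom le_eq_less_or_eq intro: coeff_eq_0)
  qed
  obtain B where B: "B > 0" "\<And>x. x \<ge> 1 \<Longrightarrow> \<bar>poly r (int x)\<bar> \<le> B * int x ^ degree r"
    using poly_le_degree_power by blast
  show ?thesis
  proof (intro exI allI impI)
    fix x assume x: "x \<ge> nat (2 * B)"
    then have x1: "x \<ge> 1" and xB: "int x \<ge> 2 * B" using B by linarith+
    have "\<bar>poly r (int x)\<bar> \<le> B * int x ^ degree r" using B x1 by blast
    also have "\<dots> \<le> B * int x ^ (D - 1)"
      using \<open>degree r < D\<close> x1 B by (intro mult_left_mono power_increasing) auto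
    finally have "2 * \<bar>poly r (int x)\<bar> \<le> 2 * B * int x ^ (D - 1)" by simp
    also have "\<dots> \<le> int x * int x ^ (D - 1)" using xB by (intro mult_right_mono) auto
    also have "\<dots> = int x ^ D" using assms by (simp add: D_def power_eq_if)
    finally have "2 * \<bar>poly r (int x)\<bar> \<le> int x ^ D" .
    moreover have "poly p (int x) = lead_coeff p * int x ^ D + poly r (int x)"
      by (simp add: r_def poly_monom)
    moreover have "int x ^ D \<le> lead_coeff p * int x ^ D" using assms by (simp add: mult_le_cancel_right1)
    ultimately show "int x ^ degree p \<le> 2 * poly p (int x)" unfolding D_def by linarith
  qed
qed

lemma poly_eventually_nonzero:
  fixes p :: "int poly"
  assumes "p \<noteq> 0"
  shows "\<exists>X0. \<forall>x\<ge>X0. poly p (int x) \<noteq> 0"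
proof -
  have "finite (nat ` {x. poly p x = 0})" using poly_roots_finite[OF assms] by simp
  then obtain b where b: "\<forall>x\<in>nat ` {x. poly p x = 0}. x < b" using finite_nat_set_iff_bounded by blast
  show ?thesis
  proof (intro exI allI impI notI)
    fix x assume "b \<le> x" "poly p (int x) = 0"
    then have "nat (int x) \<in> nat ` {x. poly p x = 0}" by blast
    then show False using b \<open>b \<le> x\<close> by auto
  qed
qed

text \<open>abc is applied to \<open>M + (g(x) - M) = g(x)\<close> after removing the common
  divisor. The primes involved divide \<open>M E H(x) F(x)\<close>. If \<open>rad F(x)\<close> were
  at most \<open>C x^(degree F - 2)\<close>, the bound
  \<open>degree F + degree H \<le> D + 1\<close> would give a radical of order at most
  \<open>x^(D-1)\<close>, too small for \<open>g(x)\<close>, which grows like \<open>x^D\<close>.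
  This loses almost a full power of \<open>x\<close> against the best exponent, but it keeps an
  arbitrary constant \<open>C\<close>.\<close>

lemma abc_radical_lower_bound:
  fixes F :: "int poly" and C :: real
  assumes abc: "abc_conjecture" and sf: "squarefree (map_poly of_int F :: rat poly)"
  shows "\<exists>X0. \<forall>x\<ge>X0. poly F (int x) \<noteq> 0 \<and>
           C * real x ^ degree F < real x ^ 2 * real (radical (nat \<bar>poly F (int x)\<bar>))"
proof -
  obtain g H M E N where g: "degree g > 0" "lead_coeff g > 0" "H \<noteq> 0" "M > 0" "E > 0"
      "degree F + degree H \<le> degree g + 1" "g * (g - [:M:]) dvd smult E ((F * H) ^ N)"
    using ex_int_belyi[OF sf] by blast
  define D where "D = degree g"
  have D: "D > 0" using g by (simp add: D_def)
  \<comment> \<open>With \<open>\<epsilon> = 1/D\<close> the exponent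
    \<open>(D - 1) * \<theta>\<close> equals \<open>D - 1/D\<close>, which is still below
    \<open>D\<close>.\<close>
  define \<theta> where "\<theta> = 1 + 1 / real D"
  have \<theta>: "\<theta> > 1" "\<theta> \<ge> 0" using D by (auto simp: \<theta>_def)
  have "\<exists>K::real. \<forall>a b c::nat. a > 0 \<longrightarrow> b > 0 \<longrightarrow> coprime a b \<longrightarrow> a + b = c \<longrightarrow>
          real c < K * real (radical (a * b * c)) powr \<theta>"
    using abc D unfolding abc_conjecture_def \<theta>_def by simp
  then obtain K0 :: real where K0: "\<And>a b. a > 0 \<Longrightarrow> b > 0 \<Longrightarrow> coprime a b \<Longrightarrow>
          real (a + b) < K0 * real (radical (a * b * (a + b))) powr \<theta>"
    by blast
  define K where "K = max K0 1"
  have K: "K > 0" "K0 \<le> K" by (auto simp: K_def)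
  define C' where "C' = max C 1"
  have C': "C' > 0" "C \<le> C'" by (auto simp: C'_def)
  obtain B where B: "B > 0" "\<And>x. x \<ge> 1 \<Longrightarrow> \<bar>poly H (int x)\<bar> \<le> B * int x ^ degree H"
    using poly_le_degree_power by blast
  have "F \<noteq> 0" using sf by auto
  then obtain X1 where X1: "\<And>x. x \<ge> X1 \<Longrightarrow> poly F (int x) \<noteq> 0" using poly_eventually_nonzero by blast
  obtain X2 where X2: "\<And>x. x \<ge> X2 \<Longrightarrow> poly H (int x) \<noteq> 0" using poly_eventually_nonzero g by blast
  obtain X3 where X3: "\<And>x. x \<ge> X3 \<Longrightarrow> int x ^ D \<le> 2 * poly g (int x)"
    using poly_ge_degree_power[OF g(1,2)] unfolding D_def by blast
  define C2 where "C2 = real_of_int (M * E * B) * C'"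
  have C2: "C2 > 0" using g B C' by (simp add: C2_def)
  define C3 where "C3 = 2 * M * K * C2 powr \<theta>"
  have C3: "C3 > 0" using g K C2 by (simp add: C3_def)
  \<comment> \<open>The entry \<open>2 * M + 1\<close> yields \<open>g(x) > M\<close>, so that both
    summands are positive; the last one yields \<open>C3 \<le> x^(1/D)\<close>, which the final
    comparison contradicts.\<close>
  define X0 where "X0 = Max {1, X1, X2, X3, nat (2 * M) + 1, nat \<lceil>C3 powr D\<rceil>}"
  have "C * real x ^ degree F < real x ^ 2 * real (radical (nat \<bar>poly F (int x)\<bar>))" if "x \<ge> X0" for x
  proof (rule ccontr)
    assume neg: "\<not> ?thesis"
    have x: "x \<ge> 1" "x \<ge> X1" "x \<ge> X2" "x \<ge> X3" "x > nat (2 * M)" "x \<ge> nat \<lceil>C3 powr D\<rceil>"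
      using that by (auto simp: X0_def)
    have F0: "poly F (int x) \<noteq> 0" and H0: "poly H (int x) \<noteq> 0" using X1 X2 x by auto
    define r where "r = radical (nat \<bar>poly F (int x)\<bar>)"
    define R where "R = nat (M * E * \<bar>poly H (int x)\<bar>) * r"
    have "real x ^ 2 * real r \<le> C * real x ^ degree F" using neg by (simp add: r_def)
    also have "\<dots> \<le> C' * real x ^ degree F" using C' by (intro mult_right_mono) auto
    finally have r: "real x ^ 2 * real r \<le> C' * real x ^ degree F" .
    have R: "real R \<le> C2 * real x ^ (D - 1)"
    proof -
      have h: "real_of_int \<bar>poly H (int x)\<bar> \<le> real_of_int B * real x ^ degree H"
        using B(2)[OF x(1)] by (metis of_int_le_iff of_int_mult of_int_of_nat_eq of_int_power)
      have "real x ^ 2 * real R = real_of_int (M * E) * (real_of_int \<bar>poly H (int x)\<bar> * (real x ^ 2 * real r))"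
        using g by (simp add: R_def)
      also have "\<dots> \<le> real_of_int (M * E) * ((real_of_int B * real x ^ degree H) * (C' * real x ^ degree F))"
        using g B by (intro mult_left_mono mult_mono[OF h r]) auto
      also have "\<dots> = C2 * real x ^ (degree F + degree H)" by (simp add: C2_def power_add)
      also have "\<dots> \<le> C2 * real x ^ (D + 1)" using g(6) x C2
        by (intro mult_left_mono power_increasing) (auto simp: D_def)
      also have "\<dots> = real x ^ 2 * (C2 * real x ^ (D - 1))"
        using D by (cases D) (auto simp: power2_eq_square)
      finally show ?thesis using x by simp
    qed
    define y where "y = poly g (int x)"
    have y2: "int x ^ D \<le> 2 * y" using X3 x by (simp add: y_def)
    have "int x \<le> int x ^ D" using x D by (intro self_le_power) auto
    then have yM: "y > M" using y2 x(5) g(4) by linarith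
    define a b where "a = nat M" and "b = nat (y - M)"
    have ab: "a > 0" "b > 0" "int (a + b) = y" using yM g by (auto simp: a_def b_def)
    \<comment> \<open>The common divisor divides the constant \<open>M\<close>, so removing it costs
      only a bounded factor.\<close>
    define d where "d = gcd a b"
    define a' b' where "a' = a div d" and "b' = b div d"
    have d: "d > 0" "a = d * a'" "b = d * b'" using ab by (auto simp: d_def a'_def b'_def)
    have "a' > 0" "b' > 0" using d ab by auto
    moreover have "coprime a' b'" unfolding a'_def b'_def d_def using ab by (intro div_gcd_coprime) auto
    ultimately have abc': "real (a' + b') < K0 * real (radical (a' * b' * (a' + b'))) powr \<theta>" by (rule K0)
    have "radical (a' * b' * (a' + b')) \<le> R" unfolding R_def r_def
    proof (rule radical_le_mult_radical)
      show "0 < a' * b' * (a' + b')" using \<open>a' > 0\<close> \<open>b' > 0\<close> by simp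
      show "0 < nat (M * E * \<bar>poly H (int x)\<bar>)" using g H0 by simp
      show "0 < nat \<bar>poly F (int x)\<bar>" using F0 by simp
      fix q :: nat assume q: "prime q" "q dvd a' * b' * (a' + b')"
      then have "q dvd a * b * (a + b)" using d by (auto simp: prime_dvd_mult_iff simp flip: distrib_left)
      then have "int q dvd int (a * b * (a + b))" by (simp only: int_dvd_int_iff)
      also have "int (a * b * (a + b)) = M * (y * (y - M))" using ab yM g by (simp add: a_def b_def)
      finally have "int q dvd M \<or> int q dvd y * (y - M)" using q by (simp add: prime_dvd_mult_iff)
      moreover have "y * (y - M) dvd E * (poly F (int x) * poly H (int x)) ^ N"
      proof -
        from g(7) obtain W where "smult E ((F * H) ^ N) = g * (g - [:M:]) * W" by (rule dvdE)
        from arg_cong[OF this, of "\<lambda>p. poly p (int x)"] show ?thesis by (simp add: y_def)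
      qed
      ultimately have "int q dvd M \<or> int q dvd E * (poly F (int x) * poly H (int x)) ^ N"
        by (meson dvd_trans)
      moreover have "prime (int q)" using q by simp
      ultimately have "int q dvd M \<or> int q dvd E \<or> int q dvd poly F (int x) * poly H (int x)"
        using prime_dvd_mult_iff prime_dvd_power by blast
      then have "int q dvd M * (E * (poly F (int x) * poly H (int x)))"
        by (auto intro: dvd_mult dvd_mult2)
      also have "\<dots> = (M * E * poly H (int x)) * poly F (int x)" by simp
      finally have "int q dvd (M * E * poly H (int x)) * poly F (int x)" .
      then have "int q dvd \<bar>(M * E * poly H (int x)) * poly F (int x)\<bar>" by (simp only: dvd_abs_iff)
      also have "\<dots> = int (nat (M * E * \<bar>poly H (int x)\<bar>) * nat \<bar>poly F (int x)\<bar>)"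
        using g by (simp add: abs_mult)
      finally show "q dvd nat (M * E * \<bar>poly H (int x)\<bar>) * nat \<bar>poly F (int x)\<bar>"
        by (simp only: int_dvd_int_iff)
    qed
    then have "K0 * real (radical (a' * b' * (a' + b'))) powr \<theta> \<le> K * (C2 * real x ^ (D - 1)) powr \<theta>"
      using K \<theta> R by (intro mult_mono powr_mono2) auto
    also have "\<dots> = K * C2 powr \<theta> * (real x ^ (D - 1)) powr \<theta>" using C2 by (simp add: powr_mult)
    also have "(real x ^ (D - 1)) powr \<theta> = real x powr (real D - 1 / real D)"
    proof -
      have "(real x ^ (D - 1)) powr \<theta> = (real x powr (real D - 1)) powr \<theta>"
        using x D by (simp add: powr_realpow[symmetric] of_nat_diff)
      also have "\<dots> = real x powr ((real D - 1) * \<theta>)" by (simp add: powr_powr)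
      also have "(real D - 1) * \<theta> = real D - 1 / real D" using D by (simp add: \<theta>_def field_simps)
      finally show ?thesis .
    qed
    finally have "real (a' + b') < K * C2 powr \<theta> * real x powr (real D - 1 / real D)" using abc' by simp
    then have 1: "2 * M * real (a' + b') < C3 * real x powr (real D - 1 / real D)"
      using g(4) by (simp add: C3_def mult_ac)
    have "real x powr real D = real x ^ D" using x by (simp add: powr_realpow)
    also have "\<dots> \<le> real_of_int (2 * y)" using y2 by (metis of_int_le_iff of_int_of_nat_eq of_int_power)
    also have "\<dots> = 2 * (real d * real (a' + b'))" using ab(3) d
      by (metis of_int_mult of_int_numeral of_int_of_nat_eq of_nat_mult distrib_left)
    also have "\<dots> \<le> 2 * (M * real (a' + b'))"
    proof -
      have "d \<le> a" using ab by (simp add: d_def)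
      then have "real d \<le> M" using g(4) by (simp add: a_def)
      then show ?thesis by (intro mult_left_mono mult_right_mono) auto
    qed
    finally have "real x powr real D < C3 * real x powr (real D - 1 / real D)" using 1 by simp
    also have "\<dots> = C3 / real x powr (1 / real D) * real x powr real D" by (simp add: powr_diff)
    finally have "1 * real x powr real D < C3 / real x powr (1 / real D) * real x powr real D" by (simp only: mult_1)
    moreover have "0 < real x powr real D" using x by simp
    ultimately have "1 < C3 / real x powr (1 / real D)" by (simp only: mult_less_cancel_right_pos)
    then have "real x powr (1 / real D) < C3" using x by (simp add: field_simps)
    moreover have "C3 \<le> real x powr (1 / real D)"
    proof -
      have "C3 = (C3 powr D) powr (1 / D)" using C3 D by (simp add: powr_powr)
      also have "\<dots> \<le> real x powr (1 / D)" using x(6) by (intro powr_mono2) auto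
      finally show ?thesis .
    qed
    ultimately show False by simp
  qed
  moreover have "X1 \<le> X0" unfolding X0_def by (rule Max_ge) auto
  ultimately show ?thesis using X1 by (meson le_trans)
qed

section \<open>Power residues among polynomial values: Stepanov's method\<close>

lemma underdetermined_system_nontrivial_solution_on:
  fixes a :: "'e \<Rightarrow> 'u \<Rightarrow> 'a::field"
  assumes "finite E" "finite U" "card E < card U"
  shows "\<exists>x. (\<exists>u\<in>U. x u \<noteq> 0) \<and> (\<forall>e\<in>E. (\<Sum>u\<in>U. a e u * x u) = 0)"
proof -
  obtain g where g: "bij_betw g {..<card E} E" 
    using ex_bij_betw_nat_finite[OF assms(1)] unfolding atLeast0LessThan by blast
  obtain h where h: "bij_betw h {..<card U} U" 
    using ex_bij_betw_nat_finite[OF assms(2)] unfolding atLeast0LessThan by blast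
  obtain y where y: "\<exists>j<card U. y j \<noteq> 0" "\<forall>i<card E. (\<Sum>j<card U. a (g i) (h j) * y j) = 0"
    using underdetermined_system_nontrivial_solution[OF assms(3), of "\<lambda>i j. a (g i) (h j)"] by blast
  define x where "x u = y (the_inv_into {..<card U} h u)" for u
  have inj: "inj_on h {..<card U}" using h by (auto simp: bij_betw_def)
  have xh: "x (h j) = y j" if "j < card U" for j
    using the_inv_into_f_f[OF inj] that by (simp add: x_def)
  have "(\<Sum>u\<in>U. a e u * x u) = 0" if "e \<in> E" for e
  proof -
    have "e \<in> g ` {..<card E}" using that g by (simp add: bij_betw_def)
    then obtain i where i: "i < card E" "e = g i" by auto
    have "(\<Sum>u\<in>U. a e u * x u) = (\<Sum>j<card U. a e (h j) * x (h j))"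
      by (rule sum.reindex_bij_betw[OF h, symmetric])
    also have "\<dots> = 0" using y(2) i by (simp add: xh)
    finally show ?thesis .
  qed
  moreover obtain j where j: "j < card U" "y j \<noteq> 0" using y by auto
  then have "h j \<in> U" "x (h j) \<noteq> 0" using h xh by (auto simp: bij_betw_def)
  ultimately show ?thesis by blast
qed

lemma poly_iterated_pderiv_linear_power:
  fixes a :: "'a::idom"
  shows "poly ((pderiv ^^ l) ([:-a, 1:] ^ l * s)) a = of_nat (fact l) * poly s a"
proof (induction l arbitrary: s)
  case (Suc l)
  have "pderiv ([:-a, 1:] ^ Suc l * s) = [:-a, 1:] ^ l * (smult (of_nat (Suc l)) s + [:-a, 1:] * pderiv s)"
    unfolding pderiv_mult pderiv_power_Suc by (simp add: pderiv_pCons algebra_simps)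
  then show ?case
    by (simp only: funpow_Suc_right o_apply Suc.IH) (simp add: algebra_simps)
qed simp

text \<open>The \<open>l\<close>-th derivative at \<open>a\<close> is \<open>l!\<close> times the
  \<open>l\<close>-th Taylor coefficient, and \<open>l!\<close> is invertible in characteristic
  \<open>p\<close> for \<open>l < p\<close>; this is where \<open>M \<le> p\<close> enters.\<close>

lemma linear_power_dvd_if_pderivs_vanish:
  fixes a :: "'a::idom"
  assumes "prime p" "CHAR('a) = p" "M \<le> p"
    and "\<And>l. l < M \<Longrightarrow> poly ((pderiv ^^ l) R) a = 0"
  shows "[:-a, 1:] ^ M dvd R"
  using assms(3,4)
proof (induction M)
  case (Suc M)
  then obtain s where s: "R = [:-a, 1:] ^ M * s" by auto
  have "of_nat (fact M) * poly s a = 0"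
    using Suc.prems(2)[of M] poly_iterated_pderiv_linear_power[of M a s] by (simp add: s)
  moreover have "(of_nat (fact M) :: 'a) \<noteq> 0"
  proof -
    have "\<not> p dvd fact M" using assms(1) Suc.prems by (simp add: prime_dvd_fact_iff)
    then show ?thesis by (metis assms(2) of_nat_eq_0_iff_char_dvd)
  qed
  ultimately have "poly s a = 0" by simp
  then obtain s' where "s = [:-a, 1:] * s'" by (auto simp: poly_eq_0_iff_dvd)
  then show ?case unfolding s by (simp only: power_Suc2 mult.assoc[symmetric] dvd_triv_left)
qed simp

lemma sum_order_le_degree:
  fixes R :: "'a::idom poly"
  assumes "R \<noteq> 0" "finite W"
  shows "(\<Sum>x\<in>W. order x R) \<le> degree R"
proof -
  have "(\<Sum>x\<in>W. order x R) = (\<Sum>x\<in>W. count (proots R) x)" using assms by simp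
  also have "\<dots> \<le> (\<Sum>x\<in>W \<union> set_mset (proots R). count (proots R) x)"
    using assms poly_roots_finite[of R] by (intro sum_mono2) auto
  also have "\<dots> = (\<Sum>x\<in>set_mset (proots R). count (proots R) x)"
    using assms poly_roots_finite[of R] by (intro sum.mono_neutral_right) (auto simp: not_in_iff order_root)
  also have "\<dots> \<le> degree R" using size_proots_le[of R] by (simp add: size_multiset_overloaded_eq)
  finally show ?thesis .
qed

text \<open>
  The auxiliary polynomial is a combination of the products \<open>(x - \<alpha>)\<^sup>t f\<^bsup>i s\<^esup> (x - \<alpha>)\<^bsup>p j\<^esup>\<close>.  Their orders at the
  simple root \<open>\<alpha>\<close> of \<open>f\<close> are distinct, so it is nonzero.  On \<open>W\<close> one may replace \<open>f\<^sup>s\<close> by \<open>c\<close> and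
  \<open>(x - \<alpha>)\<^sup>p\<close> by \<open>x - \<alpha>\<^sup>p\<close>, so vanishing to order \<open>M\<close> there costs few linear conditions.
\<close>

lemma stepanov_contradiction:
  fixes f :: "'k::field poly"
  assumes p: "prime p" "CHAR('k) = p"
    and ms: "m \<ge> 2" "m * s = p - 1"
    and n: "degree f = n"
    and f: "f = [:-\<alpha>, 1:] * f1" "poly f1 \<alpha> \<noteq> 0"
    and W: "finite W" "p \<le> card W + n"
      "\<And>x. x \<in> W \<Longrightarrow> x ^ p = x \<and> poly f x \<noteq> 0 \<and> poly f x ^ s = c"
    and large: "(2 * n + 6) * ((n + 4) + (2 * n + 6) * n) < 2 * s"
  shows False
proof -
  \<comment> \<open>Since \<open>2 * J = M + 2\<close>, already for \<open>m = 2\<close> the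
    \<open>m * J * s\<close> unknowns outnumber the \<open>M * (s + M * n + J)\<close> linear
    conditions. The degree of \<open>R\<close> is at most \<open>(2 * n + 3) * p + s\<close>, and
    \<open>M\<close> exceeds \<open>2 * n + 3\<close> by three, so zeros of order \<open>M\<close>
    on all of \<open>W\<close> are too many.\<close>
  define M J where "M = 2 * n + 6" and "J = n + 4"
  define U where "U = {..<m} \<times> {..<J} \<times> {..<s}"
  define y where "y = [:-\<alpha>, 1:]"
  define \<beta> where "\<beta> = \<alpha> ^ p"
  define E where "E = {..<M} \<times> {..<s + M * n + J}"
  define kk :: "nat \<Rightarrow> nat \<Rightarrow> nat \<Rightarrow> 'k poly" where
    "kk i t = rec_nat (y ^ t) (\<lambda>l k. f * pderiv k + smult (of_nat (i * s) - of_nat l) (pderiv f * k))" for i t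
  have kk: "kk i t 0 = y ^ t"
    "kk i t (Suc l) = f * pderiv (kk i t l) + smult (of_nat (i * s) - of_nat l) (pderiv f * kk i t l)" for i t l
    by (simp_all add: kk_def)
  have degy: "degree y = 1" by (simp add: y_def)
  have dpf: "degree (pderiv q) \<le> degree q" for q :: "'k poly" 
    using degree_pderiv_le[of q] by linarith
  have deg_kk: "degree (kk i t l) \<le> t + l * n" for i t l
  proof (induction l)
    case 0
    then show ?case by (simp add: kk(1) degree_power_eq y_def)
  next
    case (Suc l)
    have "degree (f * pderiv (kk i t l)) \<le> n + (t + l * n)"
      using degree_mult_le[of f "pderiv (kk i t l)"] dpf[of "kk i t l"] Suc n by linarith
    moreover have "degree (smult (of_nat (i * s) - of_nat l) (pderiv f * kk i t l)) \<le> n + (t + l * n)"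
      using degree_mult_le[of "pderiv f" "kk i t l"] dpf[of f] Suc n degree_smult_le order_trans
      by (smt (verit) add_mono)
    ultimately show ?case unfolding kk(2) by (intro degree_add_le) auto
  qed
  \<comment> \<open>The \<open>l\<close>-th derivative as seen on \<open>W\<close>, with
    \<open>f^s\<close> replaced by \<open>c\<close> and \<open>y^p\<close> by
    \<open>x - \<beta>\<close>. Its degree is below \<open>s + M * n + J\<close>, so making all its
    coefficients vanish is cheap.\<close>
  define e where "e l = (\<lambda>(i, j, t). smult (c ^ i) (kk i t l * [:-\<beta>, 1:] ^ j))" for l
  have "card E < card U"
  proof -
    have "M * (J + M * n) < 2 * s" using large by (simp add: M_def J_def)
    then have "M * (s + M * n + J) < (M + 2) * s" by (simp add: algebra_simps)
    also have "\<dots> \<le> m * J * s" 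
    proof (rule mult_right_mono)
      have "M + 2 = 2 * J" by (simp add: M_def J_def)
      then show "M + 2 \<le> m * J" using ms(1) by simp
    qed simp
    finally show ?thesis by (simp add: E_def U_def card_cartesian_product mult_ac)
  qed
  then obtain x where x: "\<exists>u\<in>U. x u \<noteq> 0"
      "\<forall>(l, r)\<in>E. (\<Sum>u\<in>U. coeff (e l u) r * x u) = 0"
    using underdetermined_system_nontrivial_solution_on[of E U "\<lambda>(l, r) u. coeff (e l u) r"]
    by (auto simp: E_def U_def case_prod_unfold)
  have El: "(\<Sum>u\<in>U. smult (x u) (e l u)) = 0" if "l < M" for l
  proof (rule poly_eqI)
    fix r
    show "coeff (\<Sum>u\<in>U. smult (x u) (e l u)) r = coeff 0 r"
    proof (cases "r < s + M * n + J")
      case True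
      then show ?thesis using x(2) that by (auto simp: E_def coeff_sum mult.commute)
    next
      case False
      have "coeff (e l u) r = 0" if uU: "u \<in> U" for u
      proof -
        obtain i j t where u: "u = (i, j, t)" "j < J" "t < s"
          using uU unfolding U_def by (cases u) auto
        have "degree (kk i t l * [:-\<beta>, 1:] ^ j) \<le> (t + l * n) + j"
          using degree_mult_le[of "kk i t l" "[:-\<beta>, 1:] ^ j"] deg_kk[of i t l] by (simp add: degree_power_eq)
        also have "l * n \<le> M * n" using \<open>l < M\<close> by simp
        finally have "degree (e l u) < r" using False u unfolding e_def
          by (auto intro!: le_less_trans[OF degree_smult_le])
        then show ?thesis by (rule coeff_eq_0)
      qed
      then show ?thesis by (simp add: coeff_sum)
    qed
  qed
  define T where "T l = (\<lambda>(i, j, t). kk i t l * f ^ (i * s) * y ^ (p * j))" for l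
  define R where "R = (\<Sum>u\<in>U. smult (x u) (T 0 u))"
  have char_p: "(of_nat p :: 'k) = 0" using p(2) by (metis of_nat_CHAR)
  have pd_y: "pderiv (y ^ (p * j)) = 0" for j
  proof (cases "p * j")
    case (Suc k)
    have "of_nat (p * j) = (0 :: 'k)" using char_p by simp
    then show ?thesis unfolding Suc pderiv_power_Suc by simp
  next
    case 0
    then show ?thesis by (simp only: power_0 pderiv_1)
  qed
  have pd_f: "f * pderiv (f ^ k) = smult (of_nat k) (pderiv f * f ^ k)" for k
    by (cases k) (auto simp: pderiv_power_Suc mult_ac simp del: power_Suc, simp add: mult_ac)
  have pd_T: "f * pderiv (T l u) = T (Suc l) u + smult (of_nat l) (pderiv f * T l u)" for l u
  proof (cases u)
    case (fields i j t)
    have "f * pderiv (T l u) = (f * pderiv (kk i t l)) * f ^ (i * s) * y ^ (p * j) + kk i t l * (f * pderiv (f ^ (i * s))) * y ^ (p * j)"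
      by (simp add: fields T_def pderiv_mult pd_y pd_y[unfolded mult.commute[of p]] algebra_simps)
    also have "f * pderiv (kk i t l) = kk i t (Suc l) - smult (of_nat (i * s) - of_nat l) (pderiv f * kk i t l)"
      by (simp add: kk)
    finally show ?thesis unfolding pd_f by (simp add: fields T_def algebra_simps smult_diff_left)
  qed
  have R_derivs: "f ^ l * (pderiv ^^ l) R = (\<Sum>u\<in>U. smult (x u) (T l u))" for l
  proof (induction l)
    case (Suc l)
    have "f * pderiv (f ^ l * (pderiv ^^ l) R) =
        (f * pderiv (f ^ l)) * (pderiv ^^ l) R + f ^ Suc l * (pderiv ^^ Suc l) R"
      by (simp add: pderiv_mult algebra_simps)
    also have "(f * pderiv (f ^ l)) * (pderiv ^^ l) R = smult (of_nat l) (pderiv f * (f ^ l * (pderiv ^^ l) R))"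
      unfolding pd_f by (simp add: mult_ac)
    finally have "f ^ Suc l * (pderiv ^^ Suc l) R =
        f * pderiv (f ^ l * (pderiv ^^ l) R) - smult (of_nat l) (pderiv f * (f ^ l * (pderiv ^^ l) R))" by simp
    also have "\<dots> = (\<Sum>u\<in>U. smult (x u) (f * pderiv (T l u))) - (\<Sum>u\<in>U. smult (x u) (smult (of_nat l) (pderiv f * T l u)))"
      unfolding Suc.IH by (simp add: pderiv_sum pderiv_smult sum_distrib_left smult_sum2 mult_ac)
    also have "\<dots> = (\<Sum>u\<in>U. smult (x u) (T (Suc l) u))"
      unfolding sum_subtractf[symmetric] pd_T by (intro sum.cong) (simp_all add: smult_add_right)
    finally show ?case .
  qed (simp add: R_def)
  have M_le_p: "M \<le> p"
  proof -
    have "M \<le> M * ((n + 4) + M * n)" by simp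
    also have "\<dots> < 2 * s" using large by (simp add: M_def)
    also have "\<dots> \<le> m * s" using ms(1) by simp
    finally show ?thesis using ms(2) by simp
  qed
  have frob: "(z - \<alpha>) ^ p = z ^ p - \<beta>" for z
  proof -
    have "((z - \<alpha>) + \<alpha>) ^ p = (z - \<alpha>) ^ p + \<alpha> ^ p"
      by (rule freshmans_dream) (use p in simp_all)
    then have "z ^ p = (z - \<alpha>) ^ p + \<beta>" by (simp only: diff_add_cancel \<beta>_def)
    then show ?thesis by (simp only: add_diff_cancel_right')
  qed
  have vanish: "poly ((pderiv ^^ l) R) z = 0" if "z \<in> W" "l < M" for z l
  proof -
    note z = W(3)[OF that(1)]
    have "poly (T l u) z = poly (e l u) z" for u
    proof (cases u)
      case (fields i j t)
      have "poly (y ^ (p * j)) z = ((z - \<alpha>) ^ p) ^ j" by (simp add: y_def power_mult)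
      also have "\<dots> = (z - \<beta>) ^ j" using frob z by simp
      finally have "poly (y ^ (p * j)) z = (z - \<beta>) ^ j" .
      moreover have "poly (f ^ (i * s)) z = c ^ i"
        using z power_mult[of "poly f z" s i] by (simp add: mult.commute[of i s])
      ultimately show ?thesis by (simp add: fields T_def e_def)
    qed
    then have "poly (f ^ l * (pderiv ^^ l) R) z = poly (\<Sum>u\<in>U. smult (x u) (e l u)) z"
      unfolding R_derivs by (simp add: poly_sum)
    also have "\<dots> = 0" using El[OF that(2)] by simp
    finally show ?thesis using z by simp
  qed
  have finU: "finite U" by (simp add: U_def)
  have R0: "R \<noteq> 0"
  proof -
    \<comment> \<open>This is the order of the product at \<open>\<alpha>\<close>. It determines the
      indices: \<open>t\<close> is its digit in base \<open>s\<close>, and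
      \<open>t + i * s < p\<close> separates \<open>j\<close>.\<close>
    define w where "w = (\<lambda>(i, j, t). t + i * s + p * j)"
    have T0: "T 0 u = y ^ w u * f1 ^ (fst u * s)" for u
      by (cases u) (simp add: T_def w_def kk(1) f(1) y_def[symmetric] power_add power_mult_distrib mult_ac)
    have w_lt: "t + i * s < p" if "i < m" "t < s" for i t
    proof -
      have "t + i * s < Suc i * s" using that by simp
      also have "\<dots> \<le> m * s" using that by (intro mult_right_mono) auto
      finally show ?thesis using ms by simp
    qed
    have inj: "inj_on w U"
    proof (rule inj_onI)
      fix u v assume uv: "u \<in> U" "v \<in> U" "w u = w v"
      obtain i j t i' j' t' where [simp]: "u = (i, j, t)" "v = (i', j', t')" by (cases u, cases v)
      have lt: "t + i * s < p" "t' + i' * s < p" "t < s" "t' < s" using uv w_lt by (auto simp: U_def)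
      have eq: "t + i * s + p * j = t' + i' * s + p * j'" using uv by (simp add: w_def)
      have "j = (t + i * s + p * j) div p" "j' = (t' + i' * s + p * j') div p" using lt by simp_all
      then have "j = j'" using eq by simp
      moreover from this have eq': "t + i * s = t' + i' * s" using eq by simp
      have "i = (t + i * s) div s" "i' = (t' + i' * s) div s" using lt by simp_all
      then have "i = i'" using eq' by simp
      ultimately show "u = v" using eq' by simp
    qed
    define V where "V = {u\<in>U. x u \<noteq> 0}"
    have V: "finite V" "V \<noteq> {}" using finU x(1) by (auto simp: V_def)
    define w0 where "w0 = Min (w ` V)"
    obtain u0 where u0: "u0 \<in> V" "w u0 = w0" using V unfolding w0_def by (metis (no_types) Min_in finite_imageI image_iff image_is_empty)
    have w0: "w0 \<le> w u" if "u \<in> V" for u using that V by (simp add: w0_def)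
    define Q where "Q = (\<Sum>u\<in>V. smult (x u) (y ^ (w u - w0) * f1 ^ (fst u * s)))"
    have "R = (\<Sum>u\<in>V. smult (x u) (T 0 u))"
      unfolding R_def V_def using finU by (intro sum.mono_neutral_right) auto
    also have "\<dots> = y ^ w0 * Q" unfolding Q_def sum_distrib_left
    proof (intro sum.cong refl)
      fix u assume "u \<in> V"
      then have "y ^ w u = y ^ w0 * y ^ (w u - w0)" using w0 by (simp flip: power_add)
      then show "smult (x u) (T 0 u) = y ^ w0 * smult (x u) (y ^ (w u - w0) * f1 ^ (fst u * s))"
        by (simp add: T0 mult_ac)
    qed
    finally have R: "R = y ^ w0 * Q" .
    have "poly Q \<alpha> = (\<Sum>u\<in>V. if u = u0 then x u0 * poly f1 \<alpha> ^ (fst u0 * s) else 0)"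
      unfolding Q_def poly_sum
    proof (intro sum.cong refl)
      fix u assume u: "u \<in> V"
      show "poly (smult (x u) (y ^ (w u - w0) * f1 ^ (fst u * s))) \<alpha> =
          (if u = u0 then x u0 * poly f1 \<alpha> ^ (fst u0 * s) else 0)"
      proof (cases "u = u0")
        case False
        then have "w u \<noteq> w0" using u u0 inj by (auto simp: V_def dest: inj_onD)
        then have "w u - w0 > 0" using w0[OF u] by simp
        then show ?thesis using False by (simp add: y_def)
      qed (simp add: u0)
    qed
    also have "\<dots> = x u0 * poly f1 \<alpha> ^ (fst u0 * s)" using V u0 by simp
    also have "\<dots> \<noteq> 0" using u0 f(2) by (simp add: V_def)
    finally have "Q \<noteq> 0" by auto
    then show ?thesis by (simp add: R y_def)
  qed
  have "M * card W \<le> degree R"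
  proof -
    have "M * card W = (\<Sum>z\<in>W. M)" by simp
    also have "\<dots> \<le> (\<Sum>z\<in>W. order z R)"
    proof (intro sum_mono)
      fix z assume "z \<in> W"
      then have "[:-z, 1:] ^ M dvd R" using linear_power_dvd_if_pderivs_vanish[OF p M_le_p] vanish by blast
      then show "M \<le> order z R" using R0 order_divides by blast
    qed
    also have "\<dots> \<le> degree R" by (rule sum_order_le_degree[OF R0 W(1)])
    finally show ?thesis .
  qed
  also have "degree R \<le> s + n * p + p * (n + 3)"
    unfolding R_def
  proof (rule degree_sum_le[OF finU])
    fix u assume "u \<in> U"
    then obtain i j t where u: "u = (i, j, t)" "i < m" "j < J" "t < s"
      unfolding U_def by (cases u) auto
    have "degree (T 0 u) \<le> t + (n * (i * s)) + p * j"
    proof -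
      have "degree (T 0 u) \<le> degree (y ^ t) + degree (f ^ (i * s)) + degree (y ^ (p * j))"
        unfolding u T_def kk(1) by (auto intro!: degree_mult_le[THEN order_trans] add_mono)
      also have "degree (f ^ (i * s)) \<le> n * (i * s)" using degree_power_le n by metis
      finally show ?thesis using degree_power_le[of y t] degree_power_le[of y "p * j"] by (simp add: degy)
    qed
    also have "\<dots> \<le> s + n * p + p * (n + 3)"
    proof (intro add_mono)
      show "t \<le> s" using u by simp
      have "i * s \<le> m * s" using u by simp
      also have "\<dots> \<le> p" using ms by simp
      finally show "n * (i * s) \<le> n * p" by (rule mult_left_mono) simp
      show "p * j \<le> p * (n + 3)" using u by (intro mult_left_mono) (auto simp: J_def)
    qed
    finally show "degree (smult (x u) (T 0 u)) \<le> s + n * p + p * (n + 3)"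
      using degree_smult_le order_trans by blast
  qed
  finally have 1: "M * card W \<le> s + n * p + p * (n + 3)" .
  have "M * p \<le> M * card W + M * n" using W(2) by (metis distrib_left mult_le_mono2)
  with 1 have "M * p \<le> s + n * p + p * (n + 3) + M * n" by linarith
  then have "3 * p \<le> s + M * n" by (simp add: M_def algebra_simps)
  moreover have "2 * s \<le> m * s" using ms(1) by simp
  then have "2 * s < p" using ms(2) prime_gt_0_nat[OF p(1)] by simp
  moreover have "M * n \<le> M * ((n + 4) + M * n)" by (intro mult_left_mono) auto
  then have "M * n < 2 * s" using large[folded M_def] by (rule le_less_trans)
  ultimately show False by linarith
qed

text \<open>The Bezout identity with \<open>d\<close> prime to \<open>p\<close> says that
  \<open>f\<close> stays separable modulo \<open>p\<close>. Having the same \<open>s\<close>-th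
  power means lying in one coset of the subgroup of index \<open>m\<close>. Everything except
  \<open>p\<close> is quantified inside, so that a counterexample amounts to a single prime.\<close>

definition power_residue_claim :: "nat \<Rightarrow> bool" where
  "power_residue_claim p \<longleftrightarrow> (\<forall>(f::int poly) u v d m s c.
     degree f > 0 \<longrightarrow> \<not> int p dvd lead_coeff f \<longrightarrow> u * f + v * pderiv f = [:d:] \<longrightarrow> \<not> int p dvd d \<longrightarrow>
     m \<ge> 2 \<longrightarrow> m * s = p - 1 \<longrightarrow>
     (2 * degree f + 6) * ((degree f + 4) + (2 * degree f + 6) * degree f) < 2 * s \<longrightarrow>
     (\<exists>x. \<not> int p dvd poly f x \<and> \<not> [poly f x ^ s = c] (mod int p)))"

text \<open>The field supplies the root \<open>\<alpha>\<close> around which the auxiliary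
  polynomial is expanded, and the Bezout identity makes this root simple. \<open>W\<close> is the
  image of the integers, that is the prime field, without the roots of \<open>f\<close>.\<close>

lemma power_residue_claim_if_alg_closed_field:
  assumes p: "prime p" "CHAR('k::alg_closed_field) = p"
  shows "power_residue_claim p"
  unfolding power_residue_claim_def
proof (intro allI impI, rule ccontr)
  fix f u v :: "int poly" and d c :: int and m s :: nat
  assume f: "degree f > 0" "\<not> int p dvd lead_coeff f" "u * f + v * pderiv f = [:d:]" "\<not> int p dvd d"
    and ms: "m \<ge> 2" "m * s = p - 1"
    and large: "(2 * degree f + 6) * ((degree f + 4) + (2 * degree f + 6) * degree f) < 2 * s"
    and neg: "\<not> (\<exists>x. \<not> int p dvd poly f x \<and> \<not> [poly f x ^ s = c] (mod int p))"
  define \<iota> :: "int poly \<Rightarrow> 'k poly" where "\<iota> = map_poly of_int"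
  have zero: "(of_int a :: 'k) = 0 \<longleftrightarrow> int p dvd a" for a
    using p(2) by (metis of_int_eq_0_iff_char_dvd)
  have eq: "(of_int a :: 'k) = of_int b \<longleftrightarrow> [a = b] (mod int p)" for a b
    using zero[of "a - b"] by (simp add: cong_iff_dvd_diff)
  have poly: "poly (\<iota> q) (of_int x) = of_int (poly q x)" for q x by (simp add: \<iota>_def)
  have deg: "degree (\<iota> f) = degree f" 
  proof (rule antisym)
    have "coeff (\<iota> f) (degree f) \<noteq> 0" using f(2) zero by (simp add: \<iota>_def)
    then show "degree f \<le> degree (\<iota> f)" by (rule le_degree)
  qed (simp add: \<iota>_def degree_map_poly_le)
  then obtain \<alpha> where \<alpha>: "poly (\<iota> f) \<alpha> = 0" using f(1) alg_closed_imp_poly_has_root[of "\<iota> f"] by auto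
  then obtain f1 where f1: "\<iota> f = [:-\<alpha>, 1:] * f1" by (auto simp: poly_eq_0_iff_dvd)
  have "poly f1 \<alpha> \<noteq> 0"
  proof
    assume "poly f1 \<alpha> = 0"
    then have "poly (pderiv (\<iota> f)) \<alpha> = 0" 
      by (simp only: f1 pderiv_mult poly_add poly_mult) (simp add: pderiv_pCons)
    moreover have "pderiv (\<iota> f) = \<iota> (pderiv f)" unfolding \<iota>_def by (simp add: of_int_hom.map_poly_pderiv)
    moreover have "\<iota> (u * f + v * pderiv f) = \<iota> [:d:]" using f(3) by simp
    then have "\<iota> u * \<iota> f + \<iota> v * \<iota> (pderiv f) = [:of_int d:]" by (simp add: \<iota>_def hom_distribs)
    then have "poly (\<iota> u) \<alpha> * poly (\<iota> f) \<alpha> + poly (\<iota> v) \<alpha> * poly (\<iota> (pderiv f)) \<alpha> = of_int d"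
      by (metis poly_add poly_mult poly_pCons poly_0 mult_zero_right add_0_right)
    ultimately have "(of_int d :: 'k) = 0" using \<alpha> by simp
    then have "int p dvd d" by (simp only: zero)
    then show False using f(4) by blast
  qed
  define Y :: "'k set" where "Y = of_int ` {0..<int p}"
  define W where "W = Y - {x. poly (\<iota> f) x = 0}"
  have "inj_on (of_int :: int \<Rightarrow> 'k) {0..<int p}"
    by (rule inj_onI) (auto simp: eq cong_def)
  then have Y: "finite Y" "card Y = p" unfolding Y_def by (simp_all add: card_image)
  have "\<iota> f \<noteq> 0" using deg f(1) by auto
  then have "card {x. poly (\<iota> f) x = 0} \<le> degree f" "finite {x. poly (\<iota> f) x = 0}"
    using card_poly_roots_bound[of "\<iota> f"] poly_roots_finite[of "\<iota> f"] deg by auto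
  then have cardW: "p \<le> card W + degree f" using Y diff_card_le_card_Diff[of "{x. poly (\<iota> f) x = 0}" Y] by (simp add: W_def)
  have "x ^ p = x \<and> poly (\<iota> f) x \<noteq> 0 \<and> poly (\<iota> f) x ^ s = of_int c" if xW: "x \<in> W" for x
  proof -
    obtain a where a: "x = of_int a" "0 \<le> a" using xW by (auto simp: W_def Y_def)
    then have x: "x = of_nat (nat a)" by simp
    have "x ^ p = x"
    proof (cases "p dvd nat a")
      case True
      then have "x = 0" unfolding x using p(2) by (metis of_nat_eq_0_iff_char_dvd)
      then show ?thesis using p(1) by (simp add: prime_gt_0_nat)
    next
      case False
      then have "[int (nat a ^ (p - 1)) = int 1] (mod int p)"
        using fermat_theorem[OF p(1)] by (metis cong_int_iff)
      then have "(of_int (int (nat a ^ (p - 1))) :: 'k) = of_int (int 1)" by (simp only: eq)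
      then have "x ^ (p - 1) = 1"
        unfolding x by (simp only: of_int_of_nat_eq of_nat_power of_int_power of_nat_1 of_int_1)
      then have "x * x ^ (p - 1) = x" by simp
      moreover have "p = Suc (p - 1)" using prime_gt_0_nat[OF p(1)] by simp
      ultimately show ?thesis by (metis power_Suc)
    qed
    moreover have px: "poly (\<iota> f) x = of_int (poly f a)" by (simp only: a(1) poly)
    have ne: "poly (\<iota> f) x \<noteq> 0" using xW by (simp add: W_def)
    then have "\<not> int p dvd poly f a" unfolding px zero .
    then have "[poly f a ^ s = c] (mod int p)" using neg by blast
    then have "of_int (poly f a ^ s) = (of_int c :: 'k)" by (simp only: eq)
    then have "poly (\<iota> f) x ^ s = of_int c" unfolding px by (simp only: of_int_power)
    ultimately show ?thesis using ne by blast
  qed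
  moreover have "finite W" using Y(1) by (simp add: W_def)
  ultimately show False
    using stepanov_contradiction[OF p ms deg f1 \<open>poly f1 \<alpha> \<noteq> 0\<close> _ cardW _ large, of "of_int c"] by blast
qed

text \<open>
  A type of prime cardinality cannot depend on a variable.  Choosing the prime to be a counterexample
  of the claim, if there is one, proves the claim for all primes.
\<close>

definition bad_prime :: nat where
  "bad_prime = (if \<exists>p. prime p \<and> \<not> power_residue_claim p
     then SOME p. prime p \<and> \<not> power_residue_claim p else 2)"

lemma prime_bad_prime: "prime bad_prime"
proof (cases "\<exists>p. prime p \<and> \<not> power_residue_claim p")
  case True
  then show ?thesis using someI_ex[OF True] by (simp add: bad_prime_def)
next
  case False
  then show ?thesis unfolding bad_prime_def by (simp only: if_False two_is_prime_nat)
qed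

typedef bad_index = "{0..<bad_prime}"
  using prime_gt_0_nat[OF prime_bad_prime] by auto

lemma card_bad_index: "CARD(bad_index) = bad_prime"
  using type_definition.card[OF type_definition_bad_index] by simp

instance bad_index :: prime_card
  by standard (simp add: card_bad_index prime_bad_prime)

lemma power_residue_claim: "prime p \<Longrightarrow> power_residue_claim p"
proof (rule ccontr)
  assume "prime p" "\<not> power_residue_claim p"
  then have ex: "\<exists>p. prime p \<and> \<not> power_residue_claim p" by blast
  have "CHAR(bad_index mod_ring alg_closure) = bad_prime"
    by (simp add: card_bad_index)
  then have "power_residue_claim bad_prime"
    using power_residue_claim_if_alg_closed_field prime_bad_prime by blast
  moreover have "\<not> power_residue_claim bad_prime" using someI_ex[OF ex] ex by (simp add: bad_prime_def)
  ultimately show False by blast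
qed

section \<open>Values in prescribed square classes\<close>

lemma degree_diff_const:
  fixes g :: "'a::comm_ring_1 poly"
  assumes "degree g > 0"
  shows "degree (g - [:c:]) = degree g" "lead_coeff (g - [:c:]) = lead_coeff g"
proof -
  show d: "degree (g - [:c:]) = degree g"
    using degree_add_eq_left[of "- [:c:]" g] assms by (simp only: add_uminus_conv_diff degree_minus degree_pCons_0)
  show "lead_coeff (g - [:c:]) = lead_coeff g"
    unfolding d using assms by (simp add: coeff_pCons split: nat.splits)
qed

section \<open>Roots, squares and subgroups modulo a prime\<close>

lemma finite_residues: "finite {c \<in> {0..<int q}. P c}"
  by (rule finite_subset[of _ "{0..<int q}"]) auto

lemma card_insert_le_Suc: "card (insert a A) \<le> Suc (card A)"
  by (cases "finite A") (simp_all add: card_insert_if)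

lemma card_roots_mod_prime_le_degree:
  fixes g :: "int poly" and q :: nat
  assumes "prime q" "\<not> int q dvd lead_coeff g"
  shows "card {c \<in> {0..<int q}. int q dvd poly g c} \<le> degree g"
  using assms(2)
proof (induction "degree g" arbitrary: g)
  case 0
  then have "poly g c = lead_coeff g" for c using degree_eq_zeroE[of g] by (metis coeff_pCons_0 mult_zero_right poly_0 poly_pCons add_0_right degree_pCons_0 )
  then show ?case using 0 by simp
next
  case (Suc n)
  show ?case
  proof (cases "\<exists>a\<in>{0..<int q}. int q dvd poly g a")
    case False
    then have "{c \<in> {0..<int q}. int q dvd poly g c} = {}" by auto
    then show ?thesis by (simp only: card.empty)
  next
    case True
    then obtain a where a: "a \<in> {0..<int q}" "int q dvd poly g a" by blast
    obtain h where h: "g - [:poly g a:] = [:-a, 1:] * h" using linear_dvd_diff_const[of a g] by (rule dvdE)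
    have degg: "degree (g - [:poly g a:]) = degree g" using degree_diff_const(1) Suc.hyps(2) by (metis zero_less_Suc)
    have h0: "h \<noteq> 0" using h degg Suc.hyps(2) by auto
    have dh: "degree h = n" using degg h0 Suc.hyps(2) unfolding h by (simp add: degree_mult_eq del: mult_pCons_left)
    have "lead_coeff h = lead_coeff (g - [:poly g a:])"
      unfolding h by (simp add: lead_coeff_mult del: mult_pCons_left)
    also have "\<dots> = lead_coeff g" using degree_diff_const(2) Suc.hyps(2) by (metis zero_less_Suc)
    finally have "card {c \<in> {0..<int q}. int q dvd poly h c} \<le> n"
      using Suc.hyps(1)[of h] dh Suc.prems by simp
    moreover have "{c \<in> {0..<int q}. int q dvd poly g c} \<subseteq> insert a {c \<in> {0..<int q}. int q dvd poly h c}"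
    proof
      fix c assume c: "c \<in> {c \<in> {0..<int q}. int q dvd poly g c}"
      have "poly g c - poly g a = (c - a) * poly h c" using arg_cong[OF h, of "\<lambda>p. poly p c"] by (simp add: algebra_simps)
      then have "int q dvd (c - a) * poly h c" using a c by (metis dvd_diff mem_Collect_eq)
      then have "int q dvd c - a \<or> int q dvd poly h c" using assms(1) by (simp add: prime_dvd_mult_iff)
      moreover have "c = a" if "int q dvd c - a"
        using that a c by (metis (no_types, lifting) atLeastLessThan_iff cong_iff_dvd_diff cong_less_imp_eq_int mem_Collect_eq)
      ultimately show "c \<in> insert a {c \<in> {0..<int q}. int q dvd poly h c}" using c by auto
    qed
    then have "card {c \<in> {0..<int q}. int q dvd poly g c} \<le> card (insert a {c \<in> {0..<int q}. int q dvd poly h c})"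
      by (intro card_mono finite.insertI finite_residues)
    then have "card {c \<in> {0..<int q}. int q dvd poly g c} \<le> Suc (card {c \<in> {0..<int q}. int q dvd poly h c})"
      using card_insert_le_Suc by (rule order_trans)
    ultimately have "card {c \<in> {0..<int q}. int q dvd poly g c} \<le> Suc n" by linarith
    then show ?thesis using Suc.hyps by simp
  qed
qed

lemma half_power_cong_pm1:
  fixes a :: int
  assumes "prime p" "p > 2" "\<not> int p dvd a"
  shows "[a ^ ((p - 1) div 2) = 1] (mod int p) \<or> [a ^ ((p - 1) div 2) = - 1] (mod int p)"
proof -
  have "Legendre a (int p) = 1 \<or> Legendre a (int p) = - 1"
    using assms(3) by (simp add: Legendre_def cong_0_iff)
  then show ?thesis using euler_criterion[OF assms(1), of a] assms(2) cong_sym by (metis int_ops(1))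
qed

text \<open>The half powers are the quadratic characters of \<open>a\<close> and \<open>r\<close>,
  each 1 or -1. If they are not opposite, they agree and \<open>a * r\<close> is a square.\<close>

lemma ex_sqrt_mult_if_half_powers_not_opposite:
  fixes a r :: int
  assumes p: "prime p" "p > 2" and a: "\<not> int p dvd a" and r: "\<not> int p dvd r"
    and ne: "\<not> [a ^ ((p - 1) div 2) = - (r ^ ((p - 1) div 2))] (mod int p)"
  shows "\<exists>w. [w ^ 2 = a * r] (mod int p)"
proof -
  define h where "h = (p - 1) div 2"
  have pint: "prime (int p)" using p(1) by simp
  have "\<not> [a ^ h * r ^ h = - 1] (mod int p)"
  proof
    assume 1: "[a ^ h * r ^ h = - 1] (mod int p)"
    have "[r ^ h * r ^ h = 1] (mod int p)"
      using half_power_cong_pm1[OF p r] cong_mult[of "r ^ h" 1 "int p" "r ^ h" 1]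
        cong_mult[of "r ^ h" "- 1" "int p" "r ^ h" "- 1"] by (auto simp: h_def)
    then have "[a ^ h * (r ^ h * r ^ h) = a ^ h * 1] (mod int p)" by (intro cong_mult cong_refl)
    moreover have "[(a ^ h * r ^ h) * r ^ h = - 1 * r ^ h] (mod int p)" using 1 by (intro cong_mult cong_refl)
    ultimately have "[a ^ h = - (r ^ h)] (mod int p)"
      by (metis cong_sym cong_trans mult.assoc mult.right_neutral mult_minus1)
    then show False using ne by (simp add: h_def)
  qed
  moreover have ar: "\<not> int p dvd a * r" using a r prime_dvd_mult_iff[OF pint] by blast
  ultimately have "[(a * r) ^ h = 1] (mod int p)"
    using half_power_cong_pm1[OF p ar] by (simp add: h_def power_mult_distrib)
  then have "[Legendre (a * r) (int p) = 1] (mod int p)"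
    using euler_criterion[OF p(1), of "a * r"] p(2) cong_trans unfolding h_def by (metis int_ops(1))
  moreover have "Legendre (a * r) (int p) \<noteq> 1 \<Longrightarrow> Legendre (a * r) (int p) = - 1"
    using ar by (auto simp: Legendre_def cong_0_iff split: if_splits)
  moreover have "\<not> [- 1 = 1 :: int] (mod int p)"
  proof
    assume "[- 1 = 1 :: int] (mod int p)"
    then have "int p dvd 2" by (simp add: cong_iff_dvd_diff)
    then show False using zdvd_imp_le[of "int p" 2] p(2) by simp
  qed
  ultimately have "Legendre (a * r) (int p) = 1" by metis
  then have "QuadRes (int p) (a * r)" by (auto simp: Legendre_def split: if_splits)
  then show ?thesis unfolding QuadRes_def .
qed

lemma ex_cong_mult_square:
  fixes a r :: int
  assumes p: "prime p" "p > 2" and a: "\<not> int p dvd a" and r: "\<not> int p dvd r"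
    and ne: "\<not> [a ^ ((p - 1) div 2) = - (r ^ ((p - 1) div 2))] (mod int p)"
  shows "\<exists>y. \<not> int p dvd y \<and> [a = r * y ^ 2] (mod int p)"
proof -
  have pint: "prime (int p)" using p(1) by simp
  obtain w where w: "[w ^ 2 = a * r] (mod int p)"
    using ex_sqrt_mult_if_half_powers_not_opposite[OF assms] by blast
  have "coprime r (int p)" using prime_imp_coprime[OF pint r] by (simp add: coprime_commute)
  then obtain r' where r': "[r * r' = 1] (mod int p)" using cong_solve_coprime_int by blast
  define y where "y = w * r'"
  have "[r * y ^ 2 = a] (mod int p)"
  proof -
    have "r * y ^ 2 = w ^ 2 * ((r * r') * r')" by (simp add: y_def power2_eq_square)
    also have "[\<dots> = (a * r) * (1 * r')] (mod int p)" by (intro cong_mult cong_refl w r')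
    also have "(a * r) * (1 * r') = a * (r * r')" by simp
    also have "[\<dots> = a * 1] (mod int p)" by (intro cong_mult cong_refl r')
    finally show ?thesis by simp
  qed
  then have y: "[a = r * y ^ 2] (mod int p)" by (rule cong_sym)
  moreover have "\<not> int p dvd y"
  proof
    assume "int p dvd y"
    then have "int p dvd r * y ^ 2" by (simp add: power2_eq_square)
    then show False using y a by (simp add: cong_dvd_iff)
  qed
  ultimately show ?thesis by blast
qed

text \<open>These are the candidates for \<open>y0\<close>. Roots modulo the prime factors allow
  Hensel lifting, and primes above \<open>Z\<close> avoid the finitely many bad primes. The
  condition concerns prime factors only, hence it is multiplicative and its residues can form a
  group.\<close>

definition root_prime_product :: "int poly \<Rightarrow> nat \<Rightarrow> int \<Rightarrow> bool" where
  "root_prime_product f Z y \<longleftrightarrow> (\<forall>q::nat. prime q \<longrightarrow> int q dvd y \<longrightarrow> q > Z \<and> (\<exists>x. int q dvd poly f x))"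

lemma root_prime_product_mult:
  "root_prime_product f Z a \<Longrightarrow> root_prime_product f Z b \<Longrightarrow> root_prime_product f Z (a * b)"
  unfolding root_prime_product_def by (auto simp: prime_dvd_mult_iff)

lemma cong_poly_int: "[a = b] (mod m) \<Longrightarrow> [poly f a = poly f b] (mod m)" for f :: "int poly"
  by (induction f) (auto intro!: cong_add cong_mult)

text \<open>Multiplication by \<open>a\<close> permutes \<open>S\<close>; comparing the product over
  \<open>S\<close> before and after gives the claim, as in Euler's proof of Fermat's
  theorem.\<close>

lemma power_card_cong_1_of_mult_closed:
  fixes S :: "int set" and p :: nat
  assumes p: "prime p" and S: "S \<subseteq> {1..<int p}"
    and mult: "\<And>a b. a \<in> S \<Longrightarrow> b \<in> S \<Longrightarrow> (a * b) mod int p \<in> S" and a: "a \<in> S"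
  shows "[a ^ card S = 1] (mod int p)"
proof -
  have fin: "finite S" using S finite_subset by blast
  have cop: "coprime b (int p)" if "b \<in> S" for b
  proof -
    have "\<not> int p dvd b" using that S zdvd_not_zless[of b "int p"] by auto
    then show ?thesis using p by (metis coprime_commute prime_imp_coprime prime_nat_int_transfer)
  qed
  define \<phi> where "\<phi> b = (a * b) mod int p" for b
  have "inj_on \<phi> S"
  proof (rule inj_onI)
    fix b c assume bc: "b \<in> S" "c \<in> S" "\<phi> b = \<phi> c"
    then have "[a * b = a * c] (mod int p)" by (simp add: \<phi>_def cong_def)
    then have "[b = c] (mod int p)" using cop[OF a] by (simp add: cong_mult_lcancel)
    moreover have "0 \<le> b" "b < int p" "0 \<le> c" "c < int p" using bc S by force+
    ultimately show "b = c" using cong_less_imp_eq_int by blast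
  qed
  moreover have "\<phi> ` S \<subseteq> S" using mult a by (auto simp: \<phi>_def)
  ultimately have im: "\<phi> ` S = S" using fin by (simp add: endo_inj_surj)
  have "[(\<Prod>b\<in>S. a * b) = (\<Prod>b\<in>S. \<phi> b)] (mod int p)"
    by (intro cong_prod) (simp add: \<phi>_def cong_def)
  also have "(\<Prod>b\<in>S. \<phi> b) = \<Prod>S" using prod.reindex[OF \<open>inj_on \<phi> S\<close>, of "\<lambda>x. x"] im by simp
  finally have "[a ^ card S * \<Prod>S = 1 * \<Prod>S] (mod int p)" by (simp add: prod.distrib)
  moreover have "coprime (\<Prod>S) (int p)" using cop by (intro prod_coprime_left)
  ultimately show ?thesis using cong_mult_rcancel by blast
qed

text \<open>With \<open>g = gcd (card S) (p - 1)\<close>, all elements of \<open>S\<close> are roots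
  of \<open>x^g - 1\<close> modulo \<open>p\<close>. So \<open>card S \<le> g\<close>, which forces
  equality.\<close>

lemma card_dvd_of_mult_closed:
  fixes S :: "int set" and p :: nat
  assumes p: "prime p" and S: "S \<subseteq> {1..<int p}" and ne: "1 \<in> S"
    and mult: "\<And>a b. a \<in> S \<Longrightarrow> b \<in> S \<Longrightarrow> (a * b) mod int p \<in> S"
  shows "card S dvd p - 1"
proof -
  have fin: "finite S" using S finite_subset by blast
  define g where "g = gcd (card S) (p - 1)"
  have "card S > 0" using ne fin by (auto simp: card_gt_0_iff)
  then have g0: "g > 0" by (simp add: g_def)
  have "[a ^ g = 1] (mod int p)" if a: "a \<in> S" for a
  proof -
    have "1 \<le> a \<and> a < int p" using S a by force
    then have a1: "a = int (nat a)" "nat a > 0" "nat a < p" by auto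
    have "\<not> p dvd nat a" using a1 by (auto dest: dvd_imp_le)
    then have 1: "[nat a ^ (p - 1) = 1] (mod p)" using fermat_theorem[OF p] by blast
    have "[int (nat a ^ card S) = int 1] (mod int p)"
      using power_card_cong_1_of_mult_closed[OF p S mult a] a1(1) by simp
    then have 2: "[nat a ^ card S = 1] (mod p)" by (simp only: cong_int_iff)
    have "ord p (nat a) dvd g" unfolding g_def using 1 2 ord_divides by (metis gcd_greatest)
    then have "[nat a ^ g = 1] (mod p)" using ord_divides by blast
    then have "[int (nat a ^ g) = int 1] (mod int p)" by (simp only: cong_int_iff)
    then show ?thesis using a1(1) by simp
  qed
  then have "S \<subseteq> {c \<in> {0..<int p}. int p dvd poly (monom 1 g - 1) c}"
    using S by (auto simp: poly_monom cong_iff_dvd_diff)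
  then have "card S \<le> card {c \<in> {0..<int p}. int p dvd poly (monom 1 g - 1) c}"
    by (rule card_mono[OF finite_residues])
  also have "\<dots> \<le> degree (monom 1 g - 1 :: int poly)"
  proof (rule card_roots_mod_prime_le_degree[OF p])
    have "lead_coeff (monom 1 g - 1 :: int poly) = 1"
      using g0 degree_add_eq_left[of "- 1" "monom 1 g :: int poly"] by (simp add: degree_monom_eq coeff_monom)
    then show "\<not> int p dvd lead_coeff (monom 1 g - 1)" using p prime_gt_1_nat by auto
  qed
  also have "\<dots> = g" using g0 degree_add_eq_left[of "- 1" "monom 1 g :: int poly"] by (simp add: degree_monom_eq)
  finally have "card S \<le> g" .
  moreover have "g dvd card S" by (simp add: g_def)
  ultimately have "g = card S" using \<open>card S > 0\<close> by (metis dvd_imp_le le_antisym)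
  then show ?thesis by (metis g_def gcd_dvd2)
qed

text \<open>Let \<open>S\<close> be the group of residues of root prime products. Every nonzero
  value of \<open>f\<close> modulo \<open>p\<close> lies in the coset \<open>e S\<close>, so
  \<open>S\<close> is large, and Stepanov's bound leaves only the full group. The same bound for
  index 2 gives a value of the form \<open>r z^2\<close>, and \<open>z\<close> is then represented
  by a root prime product.\<close>

lemma ex_value_cong_mult_square:
  fixes f u v :: "int poly" and b d :: int and Z :: nat
  assumes f: "degree f > 0" and uv: "u * f + v * pderiv f = [:d:]" "d \<noteq> 0"
    and b: "poly f b \<noteq> 0" and Z: "Z \<ge> 1"
  shows "\<exists>P0. \<forall>p r. prime p \<longrightarrow> p > P0 \<longrightarrow> \<not> int p dvd r \<longrightarrow>
    (\<exists>x y. root_prime_product f Z y \<and> \<not> int p dvd y \<and> [poly f x = r * y ^ 2] (mod int p))"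
proof -
  define n where "n = degree f"
  define e where "e = poly f b"
  define L where "L = (2 * n + 6) * ((n + 4) + (2 * n + 6) * n)"
  \<comment> \<open>The first four entries keep \<open>p\<close> from dividing the leading
    coefficient, \<open>d\<close>, \<open>e\<close> and \<open>Z!\<close>. The entry
    \<open>n * (L + 2)\<close> forces \<open>card S > L\<close>, and \<open>2 * L + 2\<close> admits
    the exponent \<open>(p - 1) / 2\<close>.\<close>
  define P0 where "P0 = Max {nat \<bar>lead_coeff f\<bar>, nat \<bar>d\<bar>, nat \<bar>e\<bar>, Z, n * (L + 2), 2 * L + 2, 2}"
  show ?thesis
  proof (intro exI[of _ P0] allI impI)
    fix p :: nat and r :: int
    assume p: "prime p" "p > P0" and r: "\<not> int p dvd r"
    have "nat \<bar>lead_coeff f\<bar> \<le> P0" "nat \<bar>d\<bar> \<le> P0" "nat \<bar>e\<bar> \<le> P0" "Z \<le> P0" "n * (L + 2) \<le> P0"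
        "2 * L + 2 \<le> P0" "2 \<le> P0"
      unfolding P0_def by (rule Max_ge; simp)+
    then have big: "p > nat \<bar>lead_coeff f\<bar>" "p > nat \<bar>d\<bar>" "p > nat \<bar>e\<bar>" "p > Z" "p > n * (L + 2)"
        "p > 2 * L + 2" "p > 2"
      using p(2) by linarith+
    have small: "\<not> int p dvd c" if "c \<noteq> 0" "p > nat \<bar>c\<bar>" for c
      using that dvd_imp_le_int[of c "int p"] by auto
    have pint: "prime (int p)" using p(1) by simp
    have "lead_coeff f \<noteq> 0" using f by auto
    then have lc: "\<not> int p dvd lead_coeff f" using small big(1) by blast
    have pd: "\<not> int p dvd d" using small[OF uv(2) big(2)] .
    have "e \<noteq> 0" using b by (simp add: e_def)
    then have pe: "\<not> int p dvd e" using small big(3) by blast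
    have claim: "\<exists>x. \<not> int p dvd poly f x \<and> \<not> [poly f x ^ s = c] (mod int p)"
      if "m \<ge> 2" "m * s = p - 1" "L < 2 * s" for m s c
      by (rule power_residue_claim[OF p(1), unfolded power_residue_claim_def, rule_format,
            OF f lc uv(1) pd that(1,2) that(3)[unfolded L_def n_def]])
    define S where "S = {a \<in> {1..<int p}. \<exists>y. root_prime_product f Z y \<and> [y = a] (mod int p)}"
    have inS: "y mod int p \<in> S" if "root_prime_product f Z y" "\<not> int p dvd y" for y
    proof -
      have "y mod int p \<noteq> 0" using that(2) by (simp add: dvd_eq_mod_eq_0)
      moreover have "0 \<le> y mod int p" "y mod int p < int p" using prime_gt_0_nat[OF p(1)] by auto
      ultimately show ?thesis using that(1) unfolding S_def by (auto simp: cong_def)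
    qed
    have S: "S \<subseteq> {1..<int p}" by (auto simp: S_def)
    have notdvd: "\<not> int p dvd a" if "a \<in> S" for a using that S zdvd_not_zless[of a "int p"] by auto
    have mult: "(a * b) mod int p \<in> S" if ab: "a \<in> S" "b \<in> S" for a b
    proof -
      obtain y z where yz: "root_prime_product f Z y" "[y = a] (mod int p)" "root_prime_product f Z z" "[z = b] (mod int p)"
        using ab by (auto simp: S_def)
      then have c: "[y * z = a * b] (mod int p)" by (intro cong_mult)
      have "\<not> int p dvd a * b" using notdvd[OF ab(1)] notdvd[OF ab(2)] prime_dvd_mult_iff[OF pint] by blast
      then have "\<not> int p dvd y * z" using c by (simp add: cong_dvd_iff)
      then have "(y * z) mod int p \<in> S" using yz by (intro inS root_prime_product_mult)
      then show ?thesis using c by (simp add: cong_def)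
    qed
    have "root_prime_product f Z 1" by (simp add: root_prime_product_def)
    then have one: "1 \<in> S" using prime_gt_1_nat[OF p(1)] inS[of 1] by simp
    have finS: "finite S" using S finite_subset by blast
    define k where "k = card S"
    have k_dvd: "k dvd p - 1" unfolding k_def by (rule card_dvd_of_mult_closed[OF p(1) S one mult])
    have value_S: "\<exists>a\<in>S. [poly f x = e * a] (mod int p)" if x: "\<not> int p dvd poly f x" for x
    proof -
      have "coprime (int p) (e * fact Z)"
      proof -
        have "\<not> p dvd fact Z" using big(4) p(1) by (simp add: prime_dvd_fact_iff)
        then have "\<not> int p dvd fact Z" by (metis int_dvd_int_iff of_nat_fact)
        then have "\<not> int p dvd e * fact Z" using pe prime_dvd_mult_iff[OF pint] by blast
        then show ?thesis by (rule prime_imp_coprime[OF pint])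
      qed
      \<comment> \<open>Moving \<open>x\<close> to \<open>z\<close> keeps the value modulo
        \<open>p\<close> but makes \<open>poly f z / e\<close> congruent to 1 modulo
        \<open>Z!\<close>, so this quotient has only prime factors above \<open>Z\<close>, and
        \<open>z\<close> itself is a root of \<open>f\<close> modulo each of them.\<close>
      then obtain z where z: "[z = x] (mod int p)" "[z = b] (mod e * fact Z)"
        using binary_chinese_remainder_int by blast
      have "[poly f z = e] (mod e * fact Z)" using cong_poly_int[OF z(2)] by (simp add: e_def)
      then obtain k where "poly f z - e = e * fact Z * k" by (auto simp: cong_iff_dvd_diff)
      then have fz: "poly f z = e * (1 + fact Z * k)" by (simp add: algebra_simps)
      define y where "y = 1 + fact Z * k"
      have px: "[poly f z = poly f x] (mod int p)" using z(1) by (rule cong_poly_int)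
      then have "\<not> int p dvd poly f z" using x by (simp add: cong_dvd_iff)
      then have py: "\<not> int p dvd y" using fz by (auto simp: y_def)
      have "root_prime_product f Z y" unfolding root_prime_product_def
      proof (intro allI impI conjI)
        fix q :: nat assume q: "prime q" "int q dvd y"
        show "q > Z"
        proof (rule ccontr)
          assume "\<not> Z < q"
          then have "q dvd fact Z" using q(1) by (simp add: prime_dvd_fact_iff)
          then have "int q dvd fact Z * k" by (metis int_dvd_int_iff of_nat_fact dvd_mult2)
          then have "int q dvd 1" using q(2) unfolding y_def by (metis dvd_add_left_iff)
          then show False using q(1) by simp
        qed
        show "\<exists>x. int q dvd poly f x" using q(2) fz by (intro exI[of _ z]) (simp add: y_def)
      qed
      then have "y mod int p \<in> S" using py by (rule inS)
      moreover have "[poly f x = e * (y mod int p)] (mod int p)"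
        using px fz by (simp add: y_def cong_def mod_mult_right_eq)
      ultimately show ?thesis by blast
    qed
    \<comment> \<open>Apart from at most \<open>n\<close> roots, all residues are mapped into the
      \<open>k\<close> classes of \<open>e S\<close>, each attained at most \<open>n\<close>
      times.\<close>
    have card_S: "p \<le> n + n * k"
    proof -
      define \<phi> where "\<phi> x = (SOME a. a \<in> S \<and> [poly f x = e * a] (mod int p))" for x
      define N where "N = {x \<in> {0..<int p}. \<not> int p dvd poly f x}"
      have \<phi>: "\<phi> x \<in> S \<and> [poly f x = e * \<phi> x] (mod int p)" if x: "x \<in> N" for x
      proof -
        have "\<exists>a. a \<in> S \<and> [poly f x = e * a] (mod int p)"
          using value_S[of x] x unfolding N_def by blast
        then show ?thesis unfolding \<phi>_def by (rule someI_ex)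
      qed
      have fibre: "card {x \<in> N. \<phi> x = a} \<le> n" for a
      proof -
        have "{x \<in> N. \<phi> x = a} \<subseteq> {x \<in> {0..<int p}. int p dvd poly (f - [:e * a:]) x}"
        proof
          fix x assume x: "x \<in> {x \<in> N. \<phi> x = a}"
          then have "[poly f x = e * a] (mod int p)" using \<phi> by blast
          then have "int p dvd poly (f - [:e * a:]) x" by (simp add: cong_iff_dvd_diff)
          then show "x \<in> {x \<in> {0..<int p}. int p dvd poly (f - [:e * a:]) x}" using x by (simp add: N_def)
        qed
        then have "card {x \<in> N. \<phi> x = a} \<le> card {x \<in> {0..<int p}. int p dvd poly (f - [:e * a:]) x}"
          by (rule card_mono[OF finite_residues])
        also have "\<dots> \<le> degree (f - [:e * a:])"
          using card_roots_mod_prime_le_degree[OF p(1), of "f - [:e * a:]"] lc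
          unfolding degree_diff_const(2)[OF f] by blast
        also have "\<dots> = n" using degree_diff_const(1)[OF f] by (simp add: n_def)
        finally show ?thesis .
      qed
      have "N = (\<Union>a\<in>S. {x \<in> N. \<phi> x = a})" using \<phi> by blast
      then have "card N = card (\<Union>a\<in>S. {x \<in> N. \<phi> x = a})" by (rule arg_cong)
      also have "\<dots> \<le> (\<Sum>a\<in>S. card {x \<in> N. \<phi> x = a})" by (rule card_UN_le[OF finS])
      also have "\<dots> \<le> (\<Sum>a\<in>S. n)" by (intro sum_mono fibre)
      also have "\<dots> = n * k" by (simp add: k_def)
      finally have "card N \<le> n * k" .
      moreover have "p \<le> card {x \<in> {0..<int p}. int p dvd poly f x} + card N"
      proof -
        have "{0..<int p} = {x \<in> {0..<int p}. int p dvd poly f x} \<union> N" unfolding N_def by blast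
        then have "card {0..<int p} = card ({x \<in> {0..<int p}. int p dvd poly f x} \<union> N)" by (rule arg_cong)
        also have "\<dots> \<le> card {x \<in> {0..<int p}. int p dvd poly f x} + card N" by (rule card_Un_le)
        finally show ?thesis by simp
      qed
      ultimately show ?thesis using card_roots_mod_prime_le_degree[OF p(1) lc] unfolding n_def by linarith
    qed
    have "n * (L + 2) < n * (k + 1)" using card_S big(5) by (simp add: algebra_simps)
    then have "L + 2 < k + 1" by (metis mult_less_cancel1)
    then have kL: "L < k" by simp
    \<comment> \<open>On the coset \<open>e S\<close> the \<open>k\<close>-th power is constantly
      \<open>e^k\<close>, which contradicts the claim if the index of \<open>S\<close> is at least
      2.\<close>
    have "k = p - 1"
    proof (rule ccontr)
      assume "k \<noteq> p - 1"
      obtain m where m: "p - 1 = k * m" using k_dvd by blast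
      have "m \<noteq> 0"
      proof
        assume "m = 0"
        then show False using m big(7) by simp
      qed
      moreover have "m \<noteq> 1" using m \<open>k \<noteq> p - 1\<close> by (metis mult.right_neutral)
      ultimately have "m \<ge> 2" by simp
      moreover have "m * k = p - 1" using m by (simp add: mult.commute)
      moreover have "L < 2 * k" using kL by simp
      ultimately have "\<exists>x. \<not> int p dvd poly f x \<and> \<not> [poly f x ^ k = e ^ k] (mod int p)"
        by (rule claim)
      then obtain x where x: "\<not> int p dvd poly f x" "\<not> [poly f x ^ k = e ^ k] (mod int p)"
        by blast
      obtain a where a: "a \<in> S" "[poly f x = e * a] (mod int p)" using value_S x(1) by blast
      have "[poly f x ^ k = e ^ k * a ^ k] (mod int p)" using cong_pow[OF a(2), of k] by (simp add: power_mult_distrib)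
      also have "[a ^ k = 1] (mod int p)"
        unfolding k_def by (rule power_card_cong_1_of_mult_closed[OF p(1) S mult a(1)])
      then have "[e ^ k * a ^ k = e ^ k * 1] (mod int p)" by (intro cong_mult cong_refl)
      finally show False using x(2) by simp
    qed
    then have "card S = card {1..<int p}" unfolding k_def by simp
    then have S_eq: "S = {1..<int p}" by (rule card_subset_eq[OF finite_atLeastLessThan_int S])
    define h where "h = (p - 1) div 2"
    have "odd p" using p(1) big(7) prime_odd_nat by blast
    then have h: "2 * h = p - 1" by (simp add: h_def)
    have "L < 2 * h" using h big(6) by simp
    then have "\<exists>x. \<not> int p dvd poly f x \<and> \<not> [poly f x ^ h = - (r ^ h)] (mod int p)"
      using h by (intro claim[of 2 h]) simp_all
    then obtain x where x: "\<not> int p dvd poly f x" "\<not> [poly f x ^ h = - (r ^ h)] (mod int p)"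
      by blast
    then obtain z where z: "\<not> int p dvd z" "[poly f x = r * z ^ 2] (mod int p)"
      using ex_cong_mult_square[OF p(1) big(7) _ r] unfolding h_def by blast
    define a where "a = z mod int p"
    have "a \<noteq> 0" using z(1) by (simp add: a_def dvd_eq_mod_eq_0)
    moreover have "0 \<le> a" "a < int p" using prime_gt_0_nat[OF p(1)] by (simp_all add: a_def)
    ultimately have aS: "a \<in> S" unfolding S_eq by simp
    then obtain y where y: "root_prime_product f Z y" "[y = a] (mod int p)" unfolding S_def by blast
    have "\<not> int p dvd y" using notdvd[OF aS] y(2) by (simp add: cong_dvd_iff)
    moreover have "[y = z] (mod int p)" using y(2) by (simp add: a_def cong_def)
    then have "[r * y ^ 2 = r * z ^ 2] (mod int p)" by (intro cong_mult cong_refl cong_pow)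
    then have "[poly f x = r * y ^ 2] (mod int p)" using z(2) cong_sym cong_trans by blast
    ultimately show "\<exists>x y. root_prime_product f Z y \<and> \<not> int p dvd y \<and> [poly f x = r * y ^ 2] (mod int p)"
      using y(1) by blast
  qed
qed

section \<open>Square divisors of polynomial values\<close>

lemma poly_taylor2:
  fixes g :: "'a::idom poly"
  shows "\<exists>R. poly g (x + h) = poly g x + h * poly (pderiv g) x + h ^ 2 * R"
proof (induction g)
  case (pCons a g)
  then obtain R where R: "poly g (x + h) = poly g x + h * poly (pderiv g) x + h ^ 2 * R" by blast
  have "poly (pCons a g) (x + h) = poly (pCons a g) x + h * poly (pderiv (pCons a g)) x
      + h ^ 2 * (x * R + poly (pderiv g) x + h * R)"
    unfolding poly_pCons R by (simp add: pderiv_pCons algebra_simps power2_eq_square)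
  then show ?case by blast
qed (auto intro: exI[of _ 0])

lemma hensel_prime_power:
  fixes h :: "int poly" and q :: nat
  assumes q: "prime q" and x: "int q dvd poly h x" "\<not> int q dvd poly (pderiv h) x"
  shows "\<exists>y. [y = x] (mod int q) \<and> int q ^ Suc k dvd poly h y"
proof (induction k)
  case 0
  then show ?case using x by (intro exI[of _ x]) auto
next
  case (Suc k)
  then obtain y where y: "[y = x] (mod int q)" "int q ^ Suc k dvd poly h y" by blast
  then obtain c where c: "poly h y = int q ^ Suc k * c" by blast
  have "\<not> int q dvd poly (pderiv h) y" using x(2) cong_poly_int[OF y(1), of "pderiv h"] by (simp add: cong_dvd_iff)
  then have "coprime (poly (pderiv h) y) (int q)" using q by (metis coprime_commute prime_imp_coprime prime_nat_int_transfer)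
  then obtain w where w: "[poly (pderiv h) y * w = 1] (mod int q)" using cong_solve_coprime_int by blast
  define t where "t = - (c * w)"
  obtain R where R: "poly h (y + int q ^ Suc k * t) = poly h y + (int q ^ Suc k * t) * poly (pderiv h) y + (int q ^ Suc k * t) ^ 2 * R"
    using poly_taylor2 by blast
  have "poly h y + (int q ^ Suc k * t) * poly (pderiv h) y = int q ^ Suc k * (c * (1 - poly (pderiv h) y * w))"
    by (simp add: c t_def algebra_simps)
  moreover have "int q dvd 1 - poly (pderiv h) y * w" using w by (metis cong_iff_dvd_diff cong_sym)
  ultimately have "int q ^ Suc k * int q dvd poly h y + (int q ^ Suc k * t) * poly (pderiv h) y"
    by (metis dvd_mult mult_dvd_mono dvd_refl)
  moreover have "int q ^ Suc k * int q dvd (int q ^ Suc k * t) ^ 2 * R"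
    by (simp add: power2_eq_square mult_ac)
  ultimately have "int q ^ Suc (Suc k) dvd poly h (y + int q ^ Suc k * t)"
    unfolding R by (simp only: power_Suc2 dvd_add)
  moreover have "[y + int q ^ Suc k * t = x] (mod int q)"
    using y(1) by (simp add: cong_iff_dvd_diff) (metis add_diff_eq diff_add_eq dvd_add dvd_mult2 dvd_triv_left add.commute mult.assoc)
  ultimately show ?case by blast
qed

lemma hensel_mod:
  fixes h :: "int poly" and N :: nat
  assumes "N > 0"
    and "\<And>q. prime q \<Longrightarrow> q dvd N \<Longrightarrow> \<exists>x. int q dvd poly h x \<and> \<not> int q dvd poly (pderiv h) x"
  shows "\<exists>x. int N dvd poly h x"
  using assms
proof (induction N rule: less_induct)
  case (less N)
  show ?case
  proof (cases "N = 1")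
    case False
    then obtain q where q: "prime q" "q dvd N" using prime_factor_nat by blast
    define k where "k = multiplicity q N"
    have k: "k > 0" using q less.prems(1) by (simp add: k_def prime_multiplicity_gt_zero_iff)
    obtain N' where N': "N = q ^ k * N'" "\<not> q dvd N'"
      using multiplicity_decompose'[of N q] less.prems(1) q unfolding k_def by (metis not_prime_unit neq0_conv)
    have "N' > 0" using N' less.prems by (cases N') auto
    moreover have "1 < q ^ k" using one_less_power[OF prime_gt_1_nat[OF q(1)] k] .
    then have "N' < N" using N' \<open>N' > 0\<close> by simp
    ultimately obtain x1 where x1: "int N' dvd poly h x1"
      using less.IH[of N'] less.prems(2) N' by (metis dvd_mult)
    obtain x0 where "int q dvd poly h x0" "\<not> int q dvd poly (pderiv h) x0" using less.prems(2) q by blast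
    then obtain x2 where x2: "int q ^ Suc (k - 1) dvd poly h x2" using hensel_prime_power[OF q(1)] by blast
    have cop: "coprime (int q ^ k) (int N')"
      using N' q by (metis coprime_int_iff coprime_power_left_iff of_nat_power prime_imp_coprime)
    then obtain x where x: "[x = x2] (mod int q ^ k)" "[x = x1] (mod int N')"
      using binary_chinese_remainder_int by blast
    have "int q ^ k dvd poly h x" using cong_poly_int[OF x(1), of h] x2 k by (simp add: cong_dvd_iff)
    moreover have "int N' dvd poly h x" using cong_poly_int[OF x(2), of h] x1 by (simp add: cong_dvd_iff)
    ultimately have "int q ^ k * int N' dvd poly h x" using cop by (rule divides_mult)
    then show ?thesis using N' by (intro exI[of _ x]) simp
  qed simp
qed

text \<open>A simple root modulo \<open>q\<close> lifts to only one class modulo \<open>q^2\<close>.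
  Hence \<open>t\<close> is determined by its residue modulo \<open>q\<close>, a root of
  \<open>g\<close>, and by the block of length \<open>q^2\<close> containing it.\<close>

lemma card_square_divisible_values_le:
  fixes g :: "int poly" and q N :: nat
  assumes q: "prime q" "\<not> int q dvd lead_coeff g"
    and simple: "\<And>x. int q dvd poly g x \<Longrightarrow> \<not> int q dvd poly (pderiv g) x"
  shows "card {t \<in> {N..<2 * N}. int q ^ 2 dvd poly g (int t)} \<le> degree g * (N div q ^ 2 + 1)"
proof -
  define T where "T = {t \<in> {N..<2 * N}. int q ^ 2 dvd poly g (int t)}"
  define C where "C = {c \<in> {0..<int q}. int q dvd poly g c}"
  define \<phi> where "\<phi> t = (int t mod int q, (t - N) div q ^ 2)" for t
  have q0: "q > 0" using q(1) by (rule prime_gt_0_nat)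
  have "inj_on \<phi> T"
  proof (rule inj_onI)
    fix s t assume st: "s \<in> T" "t \<in> T" "\<phi> s = \<phi> t"
    then have eq: "[int t = int s] (mod int q)" "(s - N) div q ^ 2 = (t - N) div q ^ 2"
      by (auto simp: \<phi>_def cong_def)
    define h where "h = int t - int s"
    have qh: "int q dvd h" using eq(1) by (simp add: cong_iff_dvd_diff h_def)
    have gs: "int q ^ 2 dvd poly g (int s)" "int q ^ 2 dvd poly g (int t)" using st by (auto simp: T_def)
    obtain R where R: "poly g (int s + h) = poly g (int s) + h * poly (pderiv g) (int s) + h ^ 2 * R"
      using poly_taylor2 by blast
    have "h * poly (pderiv g) (int s) = poly g (int t) - poly g (int s) - h ^ 2 * R"
      using R by (simp add: h_def)
    then have "int q ^ 2 dvd h * poly (pderiv g) (int s)"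
      using gs qh by (metis dvd_diff dvd_mult2 dvd_power_same)
    moreover have "int q dvd poly g (int s)" using gs(1) by (metis dvd_power dvd_trans pos2)
    then have "\<not> int q dvd poly (pderiv g) (int s)" by (rule simple)
    then have "coprime (int q ^ 2) (poly (pderiv g) (int s))"
      using q(1) by (metis coprime_power_left_iff prime_imp_coprime prime_nat_int_transfer)
    ultimately have "int q ^ 2 dvd h" by (simp add: coprime_dvd_mult_left_iff)
    then have "[int t = int s] (mod int (q ^ 2))" by (simp add: cong_iff_dvd_diff h_def)
    then have "[t = s] (mod q ^ 2)" by (simp only: cong_int_iff)
    moreover have "N \<le> s" "N \<le> t" using st by (auto simp: T_def)
    ultimately have "[t - N = s - N] (mod q ^ 2)" by (metis cong_add_lcancel_nat le_add_diff_inverse)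
    then have "s - N = t - N" using eq(2) unfolding cong_def by (metis div_mult_mod_eq)
    then show "s = t" using \<open>N \<le> s\<close> \<open>N \<le> t\<close> by simp
  qed
  moreover have "\<phi> ` T \<subseteq> C \<times> {0..N div q ^ 2}"
  proof
    fix z assume "z \<in> \<phi> ` T"
    then obtain t where t: "t \<in> T" "z = \<phi> t" by blast
    have "int q dvd poly g (int t)" using t by (auto simp: T_def intro: dvd_trans[of _ "int q ^ 2"])
    moreover have "[poly g (int t mod int q) = poly g (int t)] (mod int q)" by (rule cong_poly_int) (simp add: cong_def)
    ultimately have "int q dvd poly g (int t mod int q)" by (simp add: cong_dvd_iff)
    then have "int t mod int q \<in> C" using q0 by (simp add: C_def)
    moreover have "(t - N) div q ^ 2 \<le> N div q ^ 2" using t by (intro div_le_mono) (auto simp: T_def)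
    ultimately show "z \<in> C \<times> {0..N div q ^ 2}" by (simp add: t \<phi>_def)
  qed
  moreover have "finite (C \<times> {0..N div q ^ 2})"
    by (simp only: C_def finite_residues finite_cartesian_product finite_atLeastAtMost)
  ultimately have "card T \<le> card (C \<times> {0..N div q ^ 2})" by (metis card_image card_mono)
  also have "\<dots> = card C * (N div q ^ 2 + 1)" by (simp add: card_cartesian_product)
  also have "\<dots> \<le> degree g * (N div q ^ 2 + 1)"
    using card_roots_mod_prime_le_degree[OF q] by (intro mult_right_mono) (simp_all add: C_def)
  finally show ?thesis by (simp add: T_def)
qed

section \<open>Elementary estimates for the sieve\<close>

lemma sum_inverse_squares_le:
  assumes "Z > 0"
  shows "(\<Sum>q\<in>{Z<..Y}. 1 / real q ^ 2) \<le> 1 / real Z"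
proof (cases "Z \<le> Y")
  case True
  \<comment> \<open>The telescoping term \<open>1 / Y\<close> is subtracted to let the induction
    pass.\<close>
  have "(\<Sum>q\<in>{Z<..Y}. 1 / real q ^ 2) \<le> 1 / real Z - 1 / real Y"
    using True
  proof (induction Y rule: dec_induct)
    case base
    then show ?case by simp
  next
    case (step Y)
    have "{Z<..Suc Y} = insert (Suc Y) {Z<..Y}" using step by auto
    then have "(\<Sum>q\<in>{Z<..Suc Y}. 1 / real q ^ 2) = 1 / real (Suc Y) ^ 2 + (\<Sum>q\<in>{Z<..Y}. 1 / real q ^ 2)" by simp
    also have "\<dots> \<le> 1 / real (Suc Y) ^ 2 + (1 / real Z - 1 / real Y)" using step by simp
    also have "1 / real (Suc Y) ^ 2 \<le> 1 / real Y - 1 / real (Suc Y)"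
      using assms step by (simp add: divide_simps power2_eq_square)
    finally show ?case by simp
  qed
  also have "\<dots> \<le> 1 / real Z" by simp
  finally show ?thesis .
qed (use assms in simp)

lemma card_no_consecutive:
  fixes T :: "nat set"
  assumes "T \<subseteq> {N..<2 * N}" "\<And>t. t \<in> T \<Longrightarrow> Suc t \<notin> T"
  shows "2 * card T \<le> N + 1"
proof -
  have fin: "finite T" using assms(1) finite_subset by blast
  have "T \<inter> Suc ` T = {}" using assms(2) by auto
  then have "card (T \<union> Suc ` T) = card T + card (Suc ` T)" using fin by (intro card_Un_disjoint) auto
  then have "2 * card T = card (T \<union> Suc ` T)" by (simp add: card_image)
  also have "\<dots> \<le> card {N..2 * N}" using assms(1) by (intro card_mono) auto
  finally show ?thesis by simp
qed

lemma radical_mult_le_if_square_dvd: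
  assumes "m > 0" "q > 0" "q ^ 2 dvd m"
  shows "radical m * q \<le> m"
proof -
  obtain k where k: "m = q ^ 2 * k" using assms(3) by blast
  then have "k > 0" using assms(1) by (cases k) auto
  have "radical m \<le> (q * k) * radical 1"
  proof (rule radical_le_mult_radical)
    show "r dvd q * k * 1" if "prime r" "r dvd m" for r
      using that k by (auto simp: prime_dvd_mult_iff power2_eq_square)
  qed (use assms \<open>k > 0\<close> in auto)
  then have "radical m * q \<le> q * k * q" by (simp add: radical_def)
  then show ?thesis by (simp add: k power2_eq_square mult_ac)
qed

lemma radical_mult_le:
  assumes "a > 0" "b > 0"
  shows "radical (a * b) \<le> radical a * radical b"
proof -
  have "radical (a * b) = \<Prod>(prime_factors a \<union> prime_factors b)"
    using assms by (simp add: radical_def prime_factors_product)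
  also have "\<dots> * \<Prod>(prime_factors a \<inter> prime_factors b) = radical a * radical b"
    unfolding radical_def by (simp add: prod.union_inter)
  moreover have "\<Prod>(prime_factors a \<inter> prime_factors b) \<ge> 1"
    by (intro prod_ge_1) (auto simp: Suc_le_eq intro: prime_gt_0_nat in_prime_factors_imp_prime)
  ultimately show ?thesis by (metis mult.right_neutral mult_le_mono2)
qed

section \<open>Resultants, squarefreeness and shifts\<close>

text \<open>The rows of the Sylvester matrix are the coefficient vectors of \<open>x^i p\<close> and
  \<open>x^j q\<close>. The last row of its adjugate combines them into
  \<open>(0, ..., 0, det)\<close>, the coefficient vector of the constant polynomial.\<close>

lemma resultant_as_combination:
  fixes p q :: "'a::comm_ring_1 poly"
  assumes "degree p + degree q > 0"
  shows "\<exists>u v. u * p + v * q = [:resultant p q:]"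
proof -
  define m n N where "m = degree p" and "n = degree q" and "N = m + n"
  define S where "S = sylvester_mat p q"
  have S: "S \<in> carrier_mat N N" 
    using sylvester_carrier_mat[of p q] by (simp add: S_def N_def m_def n_def)
  define w where "w i = adj_mat S $$ (N - 1, i)" for i
  define r where "r i = (if i < n then monom 1 (n - 1 - i) * p else monom 1 (m - 1 - (i - n)) * q)" for i
  have N: "N > 0" using assms by (simp add: N_def m_def n_def)
  have coeff_r: "coeff (r i) (N - 1 - j) = S $$ (i, j)" if "i < N" "j < N" for i j
    using that unfolding S_def
    by (subst sylvester_index_mat) (auto simp: r_def N_def m_def n_def coeff_monom_mult not_less intro!: arg_cong[of _ _ "coeff _"] coeff_eq_0)
  have deg_r: "degree (r i) < N" if "i < N" for i
  proof -
    have "degree (monom 1 (n - 1 - i) * p) \<le> (n - 1 - i) + m"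
      using degree_mult_le[of "monom 1 (n - 1 - i)" p] degree_monom_le[of "1 :: 'a" "n - 1 - i"] by (simp add: m_def)
    moreover have "degree (monom 1 (m - 1 - (i - n)) * q) \<le> (m - 1 - (i - n)) + n"
      using degree_mult_le[of "monom 1 (m - 1 - (i - n))" q] degree_monom_le[of "1 :: 'a" "m - 1 - (i - n)"] by (simp add: n_def)
    ultimately show ?thesis using that by (auto simp: r_def N_def)
  qed
  have "(\<Sum>i<N. smult (w i) (r i)) = [:resultant p q:]"
  proof (rule poly_eqI)
    fix k
    show "coeff (\<Sum>i<N. smult (w i) (r i)) k = coeff [:resultant p q:] k"
    proof (cases "k < N")
      case False
      then have "coeff (r i) k = 0" if "i < N" for i using deg_r[OF that] by (intro coeff_eq_0) simp
      then show ?thesis using False N by (simp add: coeff_sum coeff_pCons split: nat.splits)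
    next
      case True
      define j where "j = N - 1 - k"
      have j: "j < N" "k = N - 1 - j" using True by (auto simp: j_def)
      have "coeff (\<Sum>i<N. smult (w i) (r i)) k = (\<Sum>i<N. adj_mat S $$ (N - 1, i) * S $$ (i, j))"
        unfolding j(2) using coeff_r j(1) by (simp add: coeff_sum w_def)
      also have "\<dots> = (adj_mat S * S) $$ (N - 1, j)"
        using adj_mat(1)[OF S] S N j(1) by (simp add: scalar_prod_def atLeast0LessThan)
      also have "\<dots> = (det S \<cdot>\<^sub>m 1\<^sub>m N) $$ (N - 1, j)" using adj_mat(3)[OF S] by simp
      also have "\<dots> = coeff [:resultant p q:] k"
        using N j by (auto simp: resultant_def S_def coeff_pCons split: nat.splits)
      finally show ?thesis .
    qed
  qed
  moreover have "\<exists>u v. (\<Sum>i\<in>I. smult (w i) (r i)) = u * p + v * q" if "finite I" for I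
    using that
  proof induction
    case empty
    then show ?case by (intro exI[of _ 0]) simp
  next
    case (insert i I)
    then obtain u v where "(\<Sum>i\<in>I. smult (w i) (r i)) = u * p + v * q" by blast
    then have "(\<Sum>i\<in>insert i I. smult (w i) (r i)) = 
        (u + (if i < n then smult (w i) (monom 1 (n - 1 - i)) else 0)) * p +
        (v + (if i < n then 0 else smult (w i) (monom 1 (m - 1 - (i - n))))) * q"
      using insert.hyps by (simp add: r_def algebra_simps)
    then show ?case by blast
  qed
  ultimately show ?thesis by (metis finite_lessThan)
qed

lemma squarefree_if_bezout:
  fixes f u v :: "int poly"
  assumes "u * f + v * pderiv f = [:d:]" "d \<noteq> 0"
  shows "squarefree (map_poly of_int f :: rat poly)"
proof (rule squarefreeI)
  fix x :: "rat poly" assume "x ^ 2 dvd map_poly of_int f"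
  then obtain k where k: "map_poly of_int f = x ^ 2 * k" by blast
  have "pderiv (map_poly of_int f :: rat poly) = x * (pderiv x * k + pderiv x * k + x * pderiv k)"
    unfolding k by (simp add: power2_eq_square pderiv_mult algebra_simps)
  then have "x dvd pderiv (map_poly of_int f)" by (metis dvd_triv_left)
  moreover have "x dvd map_poly of_int f" unfolding k by (simp add: power2_eq_square)
  ultimately have "x dvd map_poly of_int u * map_poly of_int f + map_poly of_int v * pderiv (map_poly of_int f)"
    by (intro dvd_add dvd_mult)
  also have "\<dots> = map_poly of_int (u * f + v * pderiv f)" by (simp add: hom_distribs of_int_hom.map_poly_pderiv)
  also have "\<dots> = [:of_int d:]" by (simp add: assms(1) hom_distribs)
  finally show "x dvd 1" by (rule dvd_trans) (use assms(2) in \<open>simp add: is_unit_iff_degree\<close>)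
qed

interpretation of_rat_poly_hom: map_poly_comm_ring_hom "of_rat :: rat \<Rightarrow> complex" ..

text \<open>A common factor would give two complex roots of \<open>f\<close> differing by
  \<open>A\<close>, and the differences of roots are bounded.\<close>

lemma ex_coprime_shift:
  fixes f :: "int poly"
  assumes "f \<noteq> 0"
  shows "\<exists>L. \<forall>A>L. coprime (map_poly of_int f :: rat poly) (map_poly of_int (pcompose f [:int A, 1:]))"
proof -
  define fc :: "complex poly" where "fc = map_poly of_int f"
  have "fc \<noteq> 0" using assms by (simp add: fc_def)
  then have fin: "finite ((\<lambda>(z, w). norm (w - z)) ` ({z. poly fc z = 0} \<times> {z. poly fc z = 0}))"
    using poly_roots_finite by blast
  define b where "b = Max ((\<lambda>(z, w). norm (w - z)) ` ({z. poly fc z = 0} \<times> {z. poly fc z = 0}))"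
  have b: "norm (w - z) \<le> b" if "poly fc z = 0" "poly fc w = 0" for z w
    unfolding b_def using that by (intro Max_ge[OF fin]) auto
  show ?thesis
  proof (intro exI allI impI, rule ccontr)
    fix A assume A: "A > nat \<lceil>b\<rceil>"
      and "\<not> coprime (map_poly of_int f :: rat poly) (map_poly of_int (pcompose f [:int A, 1:]))"
    then obtain c :: "rat poly" where c: "c dvd map_poly of_int f" "c dvd map_poly of_int (pcompose f [:int A, 1:])" "\<not> is_unit c"
      by (auto simp only: coprime_def)
    have "c \<noteq> 0" using c(1) assms by auto
    then have "degree c > 0" using c(3) by (simp add: is_unit_iff_degree)
    then have "degree (map_poly of_rat c :: complex poly) > 0" by simp
    then obtain z :: complex where z: "poly (map_poly of_rat c) z = 0" using alg_closed_imp_poly_has_root by blast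
    have root: "poly (map_poly of_int h) z = 0" if ch: "c dvd map_poly of_int h" for h
    proof -
      obtain k where "map_poly of_int h = c * k" using ch by blast
      then have "map_poly of_rat (map_poly of_int h :: rat poly) = (map_poly of_rat c * map_poly of_rat k :: complex poly)"
        by (simp only: of_rat_poly_hom.hom_mult)
      moreover have "map_poly of_rat (map_poly of_int h :: rat poly) = (map_poly of_int h :: complex poly)"
        by (simp add: map_poly_map_poly o_def)
      ultimately show ?thesis using z by simp
    qed
    have "poly fc z = 0" using root[OF c(1)] by (simp add: fc_def)
    moreover have "map_poly of_int (pcompose f [:int A, 1:]) = pcompose fc [:of_nat A, 1:]"
      by (simp add: fc_def hom_distribs)
    then have "poly fc (z + of_nat A) = 0" using root[OF c(2)] by (simp add: poly_pcompose add.commute)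
    ultimately have "norm ((z + of_nat A) - z) \<le> b" using b by blast
    then have "real A \<le> b" by simp
    then show False using A by linarith
  qed
qed

lemma squarefree_mult_shift:
  fixes f u v :: "int poly"
  assumes "u * f + v * pderiv f = [:d:]" "d \<noteq> 0" "f \<noteq> 0"
  shows "\<exists>L. \<forall>A>L. squarefree (map_poly of_int (f * pcompose f [:int A, 1:]) :: rat poly)"
proof -
  obtain L where L: "\<And>A. A > L \<Longrightarrow>
      coprime (map_poly of_int f :: rat poly) (map_poly of_int (pcompose f [:int A, 1:]))"
    using ex_coprime_shift[OF assms(3)] by blast
  have "squarefree (map_poly of_int (pcompose f [:int A, 1:]) :: rat poly)" for A
  proof (rule squarefree_if_bezout[OF _ assms(2)])
    have "pcompose (u * f + v * pderiv f) [:int A, 1:] = [:d:]" unfolding assms(1) by simp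
    then show "pcompose u [:int A, 1:] * pcompose f [:int A, 1:] +
        pcompose v [:int A, 1:] * pderiv (pcompose f [:int A, 1:]) = [:d:]"
      by (simp add: pderiv_pcompose pderiv_pCons pcompose_add pcompose_mult)
  qed
  then show ?thesis using L squarefree_if_bezout[OF assms(1,2)]
    by (intro exI[of _ L]) (auto simp: hom_distribs intro!: squarefree_mult_coprime)
qed

section \<open>Arguments without new square divisors, under abc\<close>

lemma abc_no_consecutive_large_square_divisors:
  fixes f :: "int poly" and A b K :: nat
  assumes abc: "abc_conjecture" and A: "A > 0" and K: "K > 0" and f: "f \<noteq> 0"
    and sf: "squarefree (map_poly of_int (f * pcompose f [:int A, 1:]) :: rat poly)"
  shows "\<exists>N0. \<forall>N\<ge>N0. \<forall>t\<in>{N..<2 * N}. \<forall>q1 q2. N \<le> K * q1 \<longrightarrow> N \<le> K * q2 \<longrightarrow>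
    int q1 ^ 2 dvd poly f (int (A * t + b)) \<longrightarrow> \<not> int q2 ^ 2 dvd poly f (int (A * Suc t + b))"
proof -
  define F where "F = f * pcompose f [:int A, 1:]"
  have F: "poly F (int (A * t + b)) = poly f (int (A * t + b)) * poly f (int (A * Suc t + b))" for t
    by (simp add: F_def poly_pcompose algebra_simps)
  obtain B where B: "B > 0" "\<And>x. x \<ge> 1 \<Longrightarrow> \<bar>poly F (int x)\<bar> \<le> B * int x ^ degree F"
    using poly_le_degree_power by blast
  \<comment> \<open>From \<open>x \<le> 3 * A * N\<close> and \<open>N \<le> K * q\<close> follows
    \<open>x^2 \<le> (3 * A * K)^2 * q1 * q2\<close>, while the two square divisors save a factor
    \<open>q1 * q2\<close> in the radical of \<open>F(x)\<close>. With \<open>B\<close> bounding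
    \<open>F(x)\<close>, this \<open>C\<close> is what the abc estimate has to beat.\<close>
  define C where "C = real ((3 * A * K) ^ 2) * real_of_int B"
  obtain X0 where X0: "\<And>x. x \<ge> X0 \<Longrightarrow> poly F (int x) \<noteq> 0"
      "\<And>x. x \<ge> X0 \<Longrightarrow> C * real x ^ degree F < real x ^ 2 * real (radical (nat \<bar>poly F (int x)\<bar>))"
    using abc_radical_lower_bound[OF abc sf[folded F_def], of C] by blast
  define N0 where "N0 = X0 + b + 1"
  show ?thesis
  proof (intro exI[of _ N0] allI ballI impI notI)
    fix N t q1 q2 :: nat
    assume N: "N \<ge> N0" and t: "t \<in> {N..<2 * N}" and q: "N \<le> K * q1" "N \<le> K * q2"
      and dvd: "int q1 ^ 2 dvd poly f (int (A * t + b))" "int q2 ^ 2 dvd poly f (int (A * Suc t + b))"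
    define x where "x = A * t + b"
    have "t \<le> A * t" using A by simp
    then have x: "x \<ge> X0" "x \<ge> 1"
      using N t unfolding x_def N0_def atLeastLessThan_iff by linarith+
    have xN: "x \<le> 3 * A * N"
    proof -
      have "A * t \<le> A * (2 * N)" using t by (intro mult_left_mono) auto
      moreover have "b \<le> N" using N by (simp add: N0_def)
      moreover have "N \<le> A * N" using A by simp
      ultimately have "A * t + b \<le> A * (2 * N) + A * N" by linarith
      then show ?thesis by (simp add: x_def)
    qed
    have q0: "q1 > 0" "q2 > 0" using q N by (auto simp: N0_def intro!: gr0I)
    define m1 m2 where "m1 = nat \<bar>poly f (int x)\<bar>" and "m2 = nat \<bar>poly f (int (A * Suc t + b))\<bar>"
    have Fx: "poly F (int x) = poly f (int x) * poly f (int (A * Suc t + b))" using F by (simp add: x_def)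
    then have m0: "m1 > 0" "m2 > 0" using X0(1)[OF x(1)] by (auto simp: m1_def m2_def)
    have Fm: "nat \<bar>poly F (int x)\<bar> = m1 * m2" unfolding Fx by (simp add: m1_def m2_def abs_mult nat_mult_distrib)
    have "q1 ^ 2 dvd m1" "q2 ^ 2 dvd m2"
      using dvd by (simp_all add: m1_def m2_def x_def flip: int_dvd_int_iff)
    then have r: "radical m1 * q1 \<le> m1" "radical m2 * q2 \<le> m2"
      using radical_mult_le_if_square_dvd m0 q0 by blast+
    have "x * x * radical (m1 * m2) \<le> (3 * A * (K * q1)) * (3 * A * (K * q2)) * (radical m1 * radical m2)"
      using xN q by (intro mult_mono radical_mult_le m0) (auto intro: order_trans mult_left_mono)
    also have "\<dots> = (3 * A * K) ^ 2 * ((radical m1 * q1) * (radical m2 * q2))"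
      by (simp add: power2_eq_square)
    also have "\<dots> \<le> (3 * A * K) ^ 2 * (m1 * m2)" using r by (intro mult_left_mono mult_mono) auto
    finally have "x ^ 2 * radical (nat \<bar>poly F (int x)\<bar>) \<le> (3 * A * K) ^ 2 * (m1 * m2)"
      unfolding Fm by (simp add: power2_eq_square)
    then have "real x ^ 2 * real (radical (nat \<bar>poly F (int x)\<bar>)) \<le> real ((3 * A * K) ^ 2) * real (m1 * m2)"
      by (metis of_nat_le_iff of_nat_mult of_nat_power)
    also have "real (m1 * m2) \<le> real_of_int B * real x ^ degree F"
    proof -
      have "int (m1 * m2) \<le> B * int x ^ degree F" using B(2)[OF x(2)] by (simp flip: Fm)
      then have "real_of_int (int (m1 * m2)) \<le> real_of_int (B * int x ^ degree F)" by (simp only: of_int_le_iff)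
      then show ?thesis by simp
    qed
    finally have "real x ^ 2 * real (radical (nat \<bar>poly F (int x)\<bar>)) \<le> C * real x ^ degree F"
      by (simp add: C_def mult_left_mono)
    then show False using X0(2)[OF x(1)] by linarith
  qed
qed

text \<open>Among the \<open>N\<close> terms, primes up to \<open>Y = N div (8 * n)\<close> spoil at
  most \<open>n * N / Z + n * Y \<le> N / 4\<close>, where \<open>Z \<ge> 8 * n\<close> makes the
  tail of the sum of \<open>1/q^2\<close> small. Larger primes never spoil two consecutive terms,
  hence at most \<open>(N + 1) / 2\<close>. Primes up to \<open>Z\<close> divide \<open>A\<close>
  and are left to the choice of \<open>b\<close>.\<close>

lemma ex_argument_without_new_square_divisors:
  fixes f u v :: "int poly" and A b Z :: nat
  assumes abc: "abc_conjecture" and f: "degree f > 0"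
    and uv: "u * f + v * pderiv f = [:d:]" "d \<noteq> 0"
    and A: "A > 0" "\<And>q. prime q \<Longrightarrow> q \<le> Z \<Longrightarrow> q dvd A"
    and Z: "8 * degree f \<le> Z" "\<bar>d\<bar> \<le> int Z" "\<bar>lead_coeff f\<bar> \<le> int Z"
    and sf: "squarefree (map_poly of_int (f * pcompose f [:int A, 1:]) :: rat poly)"
  shows "\<exists>N0. \<forall>N\<ge>N0. \<exists>t\<ge>N. \<forall>q. prime q \<longrightarrow> \<not> q dvd A \<longrightarrow> \<not> int q ^ 2 dvd poly f (int (A * t + b))"
proof -
  define n where "n = degree f"
  have n: "n > 0" using f by (simp add: n_def)
  have f0: "f \<noteq> 0" using f by auto
  have lc: "lead_coeff f \<noteq> 0" using f0 by simp
  define g where "g = pcompose f [:int b, int A:]"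
  have g: "poly g (int t) = poly f (int (A * t + b))" for t
    by (simp add: g_def poly_pcompose algebra_simps)
  have deg_g: "degree g = n" using A by (simp add: g_def n_def degree_pcompose)
  have lc_g: "lead_coeff g = lead_coeff f * int A ^ n"
    using A unfolding g_def by (subst lead_coeff_comp) (auto simp: n_def)
  have not_dvd: "\<not> int q dvd c" if "q > Z" "c \<noteq> 0" "\<bar>c\<bar> \<le> int Z" for q c
    using that dvd_imp_le_int[of c "int q"] by auto
  have count: "card {t \<in> {N..<2 * N}. int q ^ 2 dvd poly f (int (A * t + b))} \<le> n * (N div q ^ 2 + 1)"
    if q: "prime q" "\<not> q dvd A" for q N
  proof -
    have qZ: "q > Z" using q A(2) by (meson not_le)
    have pq: "prime (int q)" using q by simp
    have nd: "\<not> int q dvd lead_coeff f" "\<not> int q dvd d" using not_dvd qZ lc uv Z by blast+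
    have nA: "\<not> int q dvd int A" using q by simp
    have "card {t \<in> {N..<2 * N}. int q ^ 2 dvd poly g (int t)} \<le> degree g * (N div q ^ 2 + 1)"
    proof (rule card_square_divisible_values_le[OF q(1)])
      show "\<not> int q dvd lead_coeff g"
        unfolding lc_g using nd nA prime_dvd_mult_iff[OF pq] prime_dvd_power[OF pq] by blast
      fix x assume "int q dvd poly g x"
      then have 1: "int q dvd poly f (int b + x * int A)" by (simp add: g_def poly_pcompose)
      have 2: "\<not> int q dvd poly (pderiv f) (int b + x * int A)"
      proof
        assume "int q dvd poly (pderiv f) (int b + x * int A)"
        then have "int q dvd poly (u * f + v * pderiv f) (int b + x * int A)" using 1 by simp
        then show False using nd(2) by (simp add: uv)
      qed
      then have "\<not> int q dvd poly (pderiv f) (int b + x * int A) * int A"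
        using nA prime_dvd_mult_iff[OF pq] by blast
      then show "\<not> int q dvd poly (pderiv g) x"
        by (simp add: g_def pderiv_pcompose pderiv_pCons poly_pcompose mult.commute)
    qed
    then show ?thesis by (simp add: g deg_g)
  qed
  obtain N1 where N1: "\<And>N t q1 q2. N \<ge> N1 \<Longrightarrow> t \<in> {N..<2 * N} \<Longrightarrow> N \<le> 8 * n * q1 \<Longrightarrow> N \<le> 8 * n * q2 \<Longrightarrow>
    int q1 ^ 2 dvd poly f (int (A * t + b)) \<Longrightarrow> \<not> int q2 ^ 2 dvd poly f (int (A * Suc t + b))"
    using abc_no_consecutive_large_square_divisors[OF abc A(1) _ f0 sf, of "8 * n" b] n by fastforce
  \<comment> \<open>The extra 3 makes \<open>N / 4 + (N + 1) / 2\<close> smaller than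
    \<open>N\<close>.\<close>
  show ?thesis
  proof (rule exI[of _ "N1 + 3"], intro allI impI, rule ccontr)
    fix N assume N: "N \<ge> N1 + 3"
      and neg: "\<not> (\<exists>t\<ge>N. \<forall>q. prime q \<longrightarrow> \<not> q dvd A \<longrightarrow> \<not> int q ^ 2 dvd poly f (int (A * t + b)))"
    define Y where "Y = N div (8 * n)"
    define bad where "bad q t \<longleftrightarrow> prime q \<and> \<not> q dvd A \<and> int q ^ 2 dvd poly f (int (A * t + b))" for q t
    define T1 where "T1 = {t \<in> {N..<2 * N}. \<exists>q\<le>Y. bad q t}"
    define T2 where "T2 = {t \<in> {N..<2 * N}. \<exists>q>Y. bad q t}"
    have "{N..<2 * N} \<subseteq> T1 \<union> T2"
    proof
      fix t assume t: "t \<in> {N..<2 * N}"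
      with neg obtain q where "bad q t" unfolding bad_def by (meson atLeastLessThan_iff)
      then show "t \<in> T1 \<union> T2" using t unfolding T1_def T2_def by (cases "q \<le> Y") auto
    qed
    then have "card {N..<2 * N} \<le> card (T1 \<union> T2)" by (intro card_mono) (auto simp: T1_def T2_def)
    then have sum: "N \<le> card T1 + card T2" using card_Un_le[of T1 T2] by simp
    have large: "N \<le> 8 * n * q" if "q > Y" for q
    proof -
      have "N < 8 * n + 8 * n * Y" unfolding Y_def using n by (intro dividend_less_times_div) simp
      also have "\<dots> = 8 * n * Suc Y" by simp
      also have "\<dots> \<le> 8 * n * q" using that by (intro mult_left_mono) auto
      finally show ?thesis by simp
    qed
    have "2 * card T2 \<le> N + 1"
    proof (rule card_no_consecutive)
      show "T2 \<subseteq> {N..<2 * N}" by (auto simp: T2_def)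
      fix t assume t: "t \<in> T2"
      then obtain q1 where q1: "q1 > Y" "bad q1 t" by (auto simp: T2_def)
      show "Suc t \<notin> T2"
      proof
        assume "Suc t \<in> T2"
        then obtain q2 where "q2 > Y" "bad q2 (Suc t)" by (auto simp: T2_def)
        then show False using N1[of N t q1 q2] q1 large t N by (auto simp: bad_def T2_def)
      qed
    qed
    moreover have "4 * card T1 \<le> N"
    proof -
      define Q where "Q = {q \<in> {Z<..Y}. prime q \<and> \<not> q dvd A}"
      have "T1 \<subseteq> (\<Union>q\<in>Q. {t \<in> {N..<2 * N}. int q ^ 2 dvd poly f (int (A * t + b))})"
      proof
        fix t assume "t \<in> T1"
        then obtain q where t: "t \<in> {N..<2 * N}" and q: "q \<le> Y" "bad q t" unfolding T1_def by blast
        then have "Z < q" using A(2)[of q] unfolding bad_def by (meson not_le)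
        with q have "q \<in> Q" unfolding Q_def bad_def by simp
        then show "t \<in> (\<Union>q\<in>Q. {t \<in> {N..<2 * N}. int q ^ 2 dvd poly f (int (A * t + b))})"
          using t q unfolding bad_def by blast
      qed
      then have "card T1 \<le> card (\<Union>q\<in>Q. {t \<in> {N..<2 * N}. int q ^ 2 dvd poly f (int (A * t + b))})"
        by (intro card_mono) (auto simp: Q_def)
      also have "\<dots> \<le> (\<Sum>q\<in>Q. card {t \<in> {N..<2 * N}. int q ^ 2 dvd poly f (int (A * t + b))})"
        by (intro card_UN_le) (simp add: Q_def)
      also have "\<dots> \<le> (\<Sum>q\<in>Q. n * (N div q ^ 2 + 1))" using count by (intro sum_mono) (simp add: Q_def)
      also have "\<dots> \<le> (\<Sum>q\<in>{Z<..Y}. n * (N div q ^ 2 + 1))" by (intro sum_mono2) (auto simp: Q_def)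
      finally have "real (card T1) \<le> real (\<Sum>q\<in>{Z<..Y}. n * (N div q ^ 2 + 1))" by (simp only: of_nat_le_iff)
      also have "\<dots> \<le> (\<Sum>q\<in>{Z<..Y}. real n * real N * (1 / real q ^ 2) + real n)"
        unfolding of_nat_sum
      proof (intro sum_mono)
        fix q assume "q \<in> {Z<..Y}"
        have "real (N div q ^ 2) \<le> real N / real (q ^ 2)" by (rule of_nat_div_le_of_nat)
        then have "real n * real (N div q ^ 2) \<le> real n * (real N / real (q ^ 2))" by (intro mult_left_mono) auto
        then show "real (n * (N div q ^ 2 + 1)) \<le> real n * real N * (1 / real q ^ 2) + real n"
          by (simp add: algebra_simps)
      qed
      also have "\<dots> = real n * real N * (\<Sum>q\<in>{Z<..Y}. 1 / real q ^ 2) + real n * real (Y - Z)"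
        by (simp add: sum.distrib sum_distrib_left)
      also have "\<dots> \<le> real n * real N * (1 / real Z) + real n * real Y"
        using Z(1) n by (intro add_mono mult_left_mono sum_inverse_squares_le) (auto simp: n_def)
      also have "real n * real N * (1 / real Z) \<le> real N / 8"
      proof -
        have "8 * real n \<le> real Z" using Z(1) by (simp add: n_def)
        then have "8 * real n * real N \<le> real Z * real N" by (intro mult_right_mono) auto
        moreover have "real Z > 0" using Z(1) n by (simp add: n_def)
        ultimately show ?thesis by (simp add: field_simps)
      qed
      also have "real n * real Y \<le> real N / 8"
      proof -
        have "8 * n * Y \<le> N" by (simp add: Y_def)
        then have "real (8 * n * Y) \<le> real N" by (simp only: of_nat_le_iff)
        then show ?thesis by simp
      qed
      finally have "4 * real (card T1) \<le> real N" by simp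
      then show ?thesis by linarith
    qed
    ultimately show False using sum N by linarith
  qed
qed

section \<open>Squarefree parts in residue classes\<close>

lemma ex_common_prime_if_not_coprime:
  fixes a b :: int
  assumes "\<not> coprime a b"
  shows "\<exists>q::nat. prime q \<and> int q dvd a \<and> int q dvd b"
proof -
  have "nat (gcd a b) \<noteq> 1" using assms by (auto simp: coprime_iff_gcd_eq_1)
  then obtain q where q: "prime q" "q dvd nat (gcd a b)" using prime_factor_nat by blast
  then have "int q dvd gcd a b" by (metis gcd_ge_0_int int_dvd_int_iff int_nat_eq)
  then show ?thesis using q(1) by auto
qed

theorem theorem1p2:
  fixes f :: "int poly"
  assumes "degree f > 0"
    and "discriminant f \<noteq> 0"
    and "abc_conjecture"
  shows "\<exists>P0::nat. \<forall>p::nat. prime p \<longrightarrow> p > P0 \<longrightarrow>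
           (\<forall>r::int. \<not> int p dvd r \<longrightarrow> infinite {d \<in> S_Z f. [d = r] (mod int p)})"
proof -
  define D where "D = resultant f (pderiv f)"
  have "D \<noteq> 0" using assms(2) by (auto simp: discriminant_def D_def)
  moreover obtain u v where uv: "u * f + v * pderiv f = [:D:]"
    using resultant_as_combination[of f "pderiv f"] assms(1) unfolding D_def by auto
  ultimately have D0: "D \<noteq> 0" and uv: "u * f + v * pderiv f = [:D:]" by auto
  have f0: "f \<noteq> 0" using assms(1) by auto
  obtain b0 where b0: "poly f (int b0) \<noteq> 0" using poly_eventually_nonzero[OF f0] by blast
  define e where "e = poly f (int b0)"
  have e0: "e \<noteq> 0" using b0 by (simp add: e_def)
  \<comment> \<open>The fixed part \<open>e\<close> of the values is split once and for all;
    \<open>y1\<close> goes into \<open>y\<close>, and \<open>d0\<close> becomes a factor of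
    \<open>d\<close>.\<close>
  define d0 y1 where "d0 = squarefree_part e" and "y1 = square_part e"
  have e: "e = d0 * y1 ^ 2" unfolding d0_def y1_def by (rule squarefree_decompose)
  have d0: "squarefree d0" unfolding d0_def using e0 by (intro squarefree_squarefree_part) 
  have y10: "y1 \<noteq> 0" using e e0 by auto
  \<comment> \<open>All prime factors of \<open>D\<close>, of \<open>e\<close> and of the leading
    coefficient are at most \<open>Z\<close>. The entry \<open>8 * degree f\<close> serves the
    sieve.\<close>
  define Z where "Z = Max {8 * degree f, nat \<bar>D\<bar>, nat \<bar>lead_coeff f\<bar>, nat \<bar>e\<bar>, 1}"
  have Zb: "8 * degree f \<le> Z" "nat \<bar>D\<bar> \<le> Z" "nat \<bar>lead_coeff f\<bar> \<le> Z" "nat \<bar>e\<bar> \<le> Z" "1 \<le> Z"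
    unfolding Z_def by (rule Max_ge; simp)+
  then have Z: "8 * degree f \<le> Z" "\<bar>D\<bar> \<le> int Z" "\<bar>lead_coeff f\<bar> \<le> int Z" "\<bar>e\<bar> \<le> int Z" "1 \<le> Z" by auto
  have not_dvd: "\<not> int q dvd c" if "q > Z" "c \<noteq> 0" "\<bar>c\<bar> \<le> int Z" for q c
    using that dvd_imp_le_int[of c "int q"] by auto
  obtain P1 where P1: "\<And>p r. prime p \<Longrightarrow> p > P1 \<Longrightarrow> \<not> int p dvd r \<Longrightarrow>
      \<exists>x y. root_prime_product f Z y \<and> \<not> int p dvd y \<and> [poly f x = r * y ^ 2] (mod int p)"
    using ex_value_cong_mult_square[OF assms(1) uv D0 b0 Z(5)] by blast
  obtain L where L: "\<And>A. A > L \<Longrightarrow> squarefree (map_poly of_int (f * pcompose f [:int A, 1:]) :: rat poly)"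
    using squarefree_mult_shift[OF uv D0 f0] by blast
  show ?thesis
  proof (intro exI[of _ "P1 + L + Z"] allI impI)
    fix p :: nat and r :: int
    assume p: "prime p" "p > P1 + L + Z" and r: "\<not> int p dvd r"
    have pint: "prime (int p)" using p(1) by simp
    have pZ: "p > Z" using p(2) by simp
    have pe: "\<not> int p dvd e" using not_dvd[OF pZ e0 Z(4)] .
    have py1: "\<not> int p dvd y1"
    proof
      assume "int p dvd y1"
      then have "int p dvd e" unfolding e by (simp add: power2_eq_square)
      then show False using pe by simp
    qed
    \<comment> \<open>The square \<open>y1^2\<close> is split off from the value as well, so the
      class to be hit modulo \<open>p\<close> is that of \<open>r * y1^2\<close> up to the square of
      \<open>y0\<close>.\<close>
    have "\<not> int p dvd r * y1 ^ 2"
      using r py1 prime_dvd_mult_iff[OF pint] prime_dvd_power[OF pint] by blast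
    then obtain x0 y0 where y0: "root_prime_product f Z y0" "\<not> int p dvd y0"
        and x0: "[poly f x0 = (r * y1 ^ 2) * y0 ^ 2] (mod int p)"
      using P1[OF p(1)] p(2) by (metis add.assoc le_add1 le_less_trans)
    have y00: "y0 \<noteq> 0" using y0(2) by auto
    have prime_y0: "q > Z \<and> (\<exists>x. int q dvd poly f x)" if "prime q" "int q dvd y0" for q
      using y0(1) that unfolding root_prime_product_def by blast
    define M0 where "M0 = nat \<bar>e\<bar> * fact Z"
    \<comment> \<open>The cube, together with \<open>f(x) = y0^2\<close> modulo \<open>M1\<close>,
      makes \<open>f(x) / y0^2\<close> congruent to 1 modulo \<open>y0\<close>.\<close>
    define M1 where "M1 = nat \<bar>y0\<bar> ^ 3"
    have M0: "M0 > 0" and M1: "M1 > 0" using e0 y00 by (auto simp: M0_def M1_def)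
    have dvd_M1: "int q dvd y0" if "prime q" "q dvd M1" for q
    proof -
      have "q dvd nat \<bar>y0\<bar>" using that prime_dvd_power unfolding M1_def by blast
      then show ?thesis by (simp flip: int_dvd_int_iff)
    qed
    have dvd_M0: "q \<le> Z" if "prime q" "q dvd M0" for q
    proof -
      from that consider "q dvd nat \<bar>e\<bar>" | "q dvd fact Z" unfolding M0_def by (auto simp: prime_dvd_mult_iff)
      then show ?thesis
      proof cases
        case 1
        then have "int q dvd e" by (simp flip: int_dvd_int_iff)
        then show ?thesis using not_dvd e0 Z(4) by (meson not_less)
      next
        case 2
        then show ?thesis using that(1) by (simp add: prime_dvd_fact_iff)
      qed
    qed
    \<comment> \<open>Modulo a prime dividing \<open>y0\<close> the shifted polynomial agrees with
      \<open>f\<close>, whose root is simple because that prime exceeds \<open>Z\<close> and cannot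
      divide \<open>D\<close>.\<close>
    have "\<exists>x. int M1 dvd poly (f - [:y0 ^ 2:]) x"
    proof (rule hensel_mod[OF M1])
      fix q assume q: "prime q" "q dvd M1"
      have qy: "int q dvd y0" using dvd_M1 q by blast
      obtain x where x: "q > Z" "int q dvd poly f x" using prime_y0[OF q(1) qy] by blast
      have "\<not> int q dvd poly (pderiv f) x"
      proof
        assume "int q dvd poly (pderiv f) x"
        then have "int q dvd poly (u * f + v * pderiv f) x" using x by simp
        then show False using not_dvd[OF x(1) D0 Z(2)] by (simp add: uv)
      qed
      moreover have "int q dvd poly (f - [:y0 ^ 2:]) x" using x(2) qy by (simp add: power2_eq_square)
      ultimately show "\<exists>x. int q dvd poly (f - [:y0 ^ 2:]) x \<and> \<not> int q dvd poly (pderiv (f - [:y0 ^ 2:])) x"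
        by (auto simp: pderiv_diff pderiv_pCons)
    qed
    then obtain x1 where x1: "int M1 dvd poly f x1 - y0 ^ 2" by auto
    have cop_p: "coprime M1 p"
    proof (rule ccontr)
      assume "\<not> coprime M1 p"
      then have "p dvd M1" using p(1) prime_imp_coprime coprime_commute by blast
      then show False using dvd_M1[OF p(1)] y0(2) by blast
    qed
    have cop_0: "coprime M0 (M1 * p)"
    proof (rule ccontr)
      assume "\<not> coprime M0 (M1 * p)"
      then have "\<not> coprime (int M0) (int (M1 * p))" by (metis coprime_int_iff)
      then obtain q where "prime q" "int q dvd int M0" "int q dvd int (M1 * p)"
        using ex_common_prime_if_not_coprime by blast
      then have q: "prime q" "q dvd M0" "q dvd M1 * p" by (simp_all only: int_dvd_int_iff)
      from q(1,3) have "q dvd M1 \<or> q dvd p" by (simp only: prime_dvd_mult_iff)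
      then have "q > Z"
      proof
        assume "q dvd M1"
        then show "q > Z" using prime_y0[OF q(1) dvd_M1[OF q(1)]] by blast
      next
        assume "q dvd p"
        then show "q > Z" using primes_dvd_imp_eq[OF q(1) p(1)] pZ by blast
      qed
      then show False using dvd_M0[OF q(1,2)] by simp
    qed
    obtain z' where z': "[z' = x1] (mod int M1)" "[z' = x0] (mod int p)"
      using binary_chinese_remainder_int[of "int M1" "int p"] cop_p by auto
    obtain z where z: "[z = int b0] (mod int M0)" "[z = z'] (mod int (M1 * p))"
      using binary_chinese_remainder_int[of "int M0" "int (M1 * p)"] cop_0 by (metis coprime_int_iff)
    define A where "A = M0 * (M1 * p)"
    have A: "A > 0" using M0 M1 prime_gt_0_nat[OF p(1)] by (simp add: A_def)
    define b where "b = nat (z mod int A)"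
    have bz: "[int b = z] (mod int A)" using A by (simp add: b_def cong_def)
    have arg: "[int (A * t + b) = z] (mod int A)" for t
    proof -
      have "[int (A * t + b) = int b] (mod int A)" by (simp add: cong_def)
      then show ?thesis using bz cong_trans by blast
    qed
    \<comment> \<open>The modulus \<open>A\<close> depends on \<open>p\<close> and
      \<open>y0\<close>, but it is at least \<open>p\<close>; this is why the bound for
      \<open>p\<close> includes \<open>L\<close>.\<close>
    have "p \<le> A" using M0 M1 by (simp add: A_def Suc_le_eq)
    then have "A > L" using p(2) by simp
    note sf = L[OF this]
    have small: "q dvd A" if "prime q" "q \<le> Z" for q
      using that by (auto simp: A_def M0_def prime_dvd_fact_iff intro: dvd_mult dvd_mult2)
    obtain N0 where N0: "\<And>N. N \<ge> N0 \<Longrightarrow> \<exists>t\<ge>N. \<forall>q. prime q \<longrightarrow> \<not> q dvd A \<longrightarrow> \<not> int q ^ 2 dvd poly f (int (A * t + b))"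
      using ex_argument_without_new_square_divisors[OF assms(3,1) uv D0 A small Z(1-3) sf, of b] by blast
    define V where "V = {d \<in> S_Z f. [d = r] (mod int p)}"
    have good_value: "\<exists>d\<in>V. poly f (int (A * t + b)) = d * (y1 * y0) ^ 2"
      if t: "\<And>q. prime q \<Longrightarrow> \<not> q dvd A \<Longrightarrow> \<not> int q ^ 2 dvd poly f (int (A * t + b))" for t
    proof -
      define x where "x = int (A * t + b)"
      have xz: "[x = z] (mod int A)" unfolding x_def by (rule arg)
      have "[x = z] (mod int M0)" by (rule cong_dvd_modulus[OF xz]) (simp add: A_def)
      then have "[x = int b0] (mod int M0)" using z(1) cong_trans by blast
      moreover have "[x = z] (mod int (M1 * p))" by (rule cong_dvd_modulus[OF xz]) (simp add: A_def)
      then have xz': "[x = z'] (mod int (M1 * p))" using z(2) cong_trans by blast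
      have "[x = z'] (mod int M1)" by (rule cong_dvd_modulus[OF xz']) simp
      then have "[x = x1] (mod int M1)" using z'(1) cong_trans by blast
      moreover have "[x = z'] (mod int p)" by (rule cong_dvd_modulus[OF xz']) simp
      then have "[x = x0] (mod int p)" using z'(2) cong_trans by blast
      ultimately have x: "[poly f x = e] (mod int M0)" "[poly f x = poly f x1] (mod int M1)" "[poly f x = poly f x0] (mod int p)"
        unfolding e_def by (auto intro: cong_poly_int)
      have "e * fact Z dvd int M0" by (simp add: M0_def)
      then have "e * fact Z dvd poly f x - e" using x(1) by (metis cong_iff_dvd_diff dvd_trans)
      then obtain k where "poly f x - e = e * fact Z * k" by blast
      then have fx: "poly f x = e * (1 + fact Z * k)" by (simp add: algebra_simps)
      define w where "w = 1 + fact Z * k"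
      have fxw: "poly f x = e * w" using fx by (simp add: w_def)
      have w_small: "q > Z" if "prime q" "int q dvd w" for q
      proof (rule ccontr)
        assume "\<not> Z < q"
        then have "q dvd fact Z" using that(1) by (simp add: prime_dvd_fact_iff)
        then have "int q dvd fact Z * k" by (metis int_dvd_int_iff of_nat_fact dvd_mult2)
        then have "int q dvd 1" using that(2) unfolding w_def by (metis dvd_add_left_iff)
        then show False using that(1) by simp
      qed
      have "int M1 dvd poly f x - y0 ^ 2"
        using x(2) x1 by (metis cong_iff_dvd_diff cong_trans)
      moreover have "y0 ^ 3 dvd int M1" by (simp add: M1_def flip: power_abs)
      ultimately have "y0 ^ 3 dvd poly f x - y0 ^ 2" by (rule dvd_trans[rotated])
      then obtain j where "poly f x - y0 ^ 2 = y0 ^ 3 * j" by blast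
      then have fxy: "poly f x = y0 ^ 2 * (1 + y0 * j)" by (simp add: algebra_simps power2_eq_square power3_eq_cube)
      have "coprime (y0 ^ 2) e"
      proof (rule ccontr)
        assume "\<not> coprime (y0 ^ 2) e"
        then have "\<not> coprime y0 e" by simp
        then obtain q where q: "prime q" "int q dvd y0" "int q dvd e"
          using ex_common_prime_if_not_coprime by blast
        then show False using prime_y0[OF q(1,2)] not_dvd e0 Z(4) by blast
      qed
      moreover have "y0 ^ 2 dvd e * w" using fxw fxy by (metis dvd_triv_left)
      ultimately have "y0 ^ 2 dvd w" by (simp add: coprime_dvd_mult_right_iff)
      then obtain w' where w': "w = y0 ^ 2 * w'" by blast
      have ew': "e * w' = 1 + y0 * j"
      proof -
        have "y0 ^ 2 * (e * w') = poly f x" unfolding fxw w' by (simp only: mult.left_commute)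
        also note fxy
        finally show ?thesis using y00 by (metis mult_left_cancel power_not_zero)
      qed
      define d where "d = d0 * w'"
      have fd: "poly f x = d * (y1 * y0) ^ 2" unfolding fxw w' e d_def by (simp add: power_mult_distrib)
      have pfx: "[poly f x = (r * y1 ^ 2) * y0 ^ 2] (mod int p)" using x(3) x0 cong_trans by blast
      have w'_dvd: "int q dvd w" if "int q dvd w'" for q using that w' by simp
      have w0: "w' \<noteq> 0"
      proof
        assume "w' = 0"
        then have "poly f x = 0" using fd by (simp add: d_def)
        then have "int p dvd (r * y1 ^ 2) * y0 ^ 2" using pfx cong_dvd_iff by fastforce
        then show False using \<open>\<not> int p dvd r * y1 ^ 2\<close> y0(2) prime_dvd_mult_iff[OF pint] prime_dvd_power[OF pint] by blast
      qed
      have sq_w': "squarefree w'"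
        unfolding squarefree_factorial_semiring[OF w0]
      proof (intro allI impI notI)
        fix q' :: int assume q': "prime q'" "q' ^ 2 dvd w'"
        define q where "q = nat q'"
        have q: "prime q" "q' = int q" using q' by (auto simp: q_def prime_ge_0_int intro: prime_int_nat_transfer[THEN iffD1])
        have qw': "int q dvd w'" using q'(2) unfolding q(2) by (metis dvd_power dvd_trans pos2)
        have "q > Z" using w_small[OF q(1) w'_dvd[OF qw']] .
        have "int q ^ 2 dvd poly f (int (A * t + b))"
          using q'(2) unfolding q(2) x_def[symmetric] fd d_def by (metis dvd_mult dvd_mult2)
        then have "q dvd A" using t[OF q(1)] by blast
        \<comment> \<open>The sieve says nothing about the primes of \<open>A\<close>. Those of
          \<open>M0\<close> are at most \<open>Z\<close>, unlike the primes of \<open>w\<close>;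
          those of \<open>M1\<close> are excluded by \<open>e * w' = 1 + y0 * j\<close>, and
          \<open>p\<close> does not divide the value.\<close>
        then have "q dvd M0 \<or> q dvd M1 \<or> q dvd p"
          unfolding A_def using q(1) by (simp only: prime_dvd_mult_iff)
        then consider "q dvd M0" | "q dvd M1" | "q = p"
          using primes_dvd_imp_eq[OF q(1) p(1)] by blast
        then show False
        proof cases
          case 1
          then show False using dvd_M0[OF q(1)] \<open>q > Z\<close> by simp
        next
          case 2
          then have "int q dvd y0 * j" using dvd_M1[OF q(1)] by simp
          moreover have "int q dvd 1 + y0 * j" using qw' ew' by (metis dvd_mult)
          ultimately have "int q dvd 1" by (metis dvd_add_left_iff)
          then show False using q(1) by simp
        next
          case 3
          then have "int p dvd poly f x" using qw' fd by (simp add: d_def)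
          then have "int p dvd (r * y1 ^ 2) * y0 ^ 2" using pfx by (simp add: cong_dvd_iff)
          then show False using \<open>\<not> int p dvd r * y1 ^ 2\<close> y0(2) prime_dvd_mult_iff[OF pint] prime_dvd_power[OF pint] by blast
        qed
      qed
      have "coprime d0 w'"
      proof (rule ccontr)
        assume "\<not> coprime d0 w'"
        then obtain q where q: "prime q" "int q dvd d0" "int q dvd w'"
          using ex_common_prime_if_not_coprime by blast
        then have "int q dvd e" "q > Z" using w_small[OF q(1) w'_dvd] by (simp_all add: e)
        then show False using not_dvd e0 Z(4) by blast
      qed
      then have "squarefree d" unfolding d_def using d0 sq_w' by (rule squarefree_mult_coprime)
      moreover have "y1 * y0 \<noteq> 0" using y10 y00 by simp
      ultimately have "d \<in> S_Z f" unfolding S_Z_def mem_Collect_eq using fd[symmetric] by blast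
      moreover have "[d = r] (mod int p)"
      proof -
        have "[d * (y1 * y0) ^ 2 = r * (y1 * y0) ^ 2] (mod int p)"
          using pfx unfolding fd by (simp add: power_mult_distrib mult_ac)
        moreover have "\<not> int p dvd y1 * y0" using py1 y0(2) prime_dvd_mult_iff[OF pint] by blast
        then have "coprime ((y1 * y0) ^ 2) (int p)" using pint prime_imp_coprime coprime_commute by (metis coprime_power_left_iff)
        ultimately show ?thesis by (simp add: cong_mult_rcancel)
      qed
      ultimately show ?thesis using fd by (auto simp: V_def x_def)
    qed
    show "infinite {d \<in> S_Z f. [d = r] (mod int p)}"
    proof
      assume "finite {d \<in> S_Z f. [d = r] (mod int p)}"
      \<comment> \<open>The square part \<open>y1 * y0\<close> does not depend on \<open>t\<close>,
        so each \<open>d\<close> accounts for only finitely many arguments, namely the roots of a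
        nonconstant polynomial.\<close>
      then have "finite (\<Union>d\<in>V. {x. poly (f - [:d * (y1 * y0) ^ 2:]) x = 0})"
      proof (intro finite_UN_I poly_roots_finite)
        fix d
        show "f - [:d * (y1 * y0) ^ 2:] \<noteq> 0" using assms(1) by auto
      qed (simp add: V_def)
      then have "finite (nat ` (\<Union>d\<in>V. {x. poly (f - [:d * (y1 * y0) ^ 2:]) x = 0}))" by (rule finite_imageI)
      then obtain B where B: "\<forall>x\<in>nat ` (\<Union>d\<in>V. {x. poly (f - [:d * (y1 * y0) ^ 2:]) x = 0}). x < B"
        using finite_nat_set_iff_bounded by blast
      obtain t where t: "t \<ge> N0 + B" "\<And>q. prime q \<Longrightarrow> \<not> q dvd A \<Longrightarrow> \<not> int q ^ 2 dvd poly f (int (A * t + b))"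
        using N0[of "N0 + B"] by auto
      obtain d where "d \<in> V" "poly f (int (A * t + b)) = d * (y1 * y0) ^ 2" using good_value[OF t(2)] by blast
      then have "nat (int (A * t + b)) \<in> nat ` (\<Union>d\<in>V. {x. poly (f - [:d * (y1 * y0) ^ 2:]) x = 0})"
        by (intro imageI UN_I[of d]) auto
      then have "A * t + b < B" using B by (metis nat_int)
      moreover have "t \<le> A * t" using A by simp
      ultimately show False using t(1) by linarith
    qed
  qed
qed

end
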